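(* Let $K$ be an algebraically closed field of characteristic $0$ and let $d\geq 2$ be an integer. Let $f$ and $g$ be disintegrated polynomials in $K[x]$ of degree at most $d$ satisfying $f\approx g$. Then there exist a positive integer $N\leq 2d^4$ and a common polynomial $\eta\in K[x]$ that is semiconjugate to both $f^{\circ N}$ and $g^{\circ N}$.
   Context: For $\delta\geq 2$, the Chebyshev polynomial $T_\delta(x)\in K[x]$ is the polynomial of degree $\delta$ satisfying $T_\delta(x+\frac{1}{x})=x^\delta+\frac{1}{x^\delta}$. Two polynomials $f,g\in K[x]$ are linearly conjugate if $g=\ell\circ f\circ \ell^{-1}$ for some polynomial $\ell\in K[x]$ of degree $1$. A polynomial $f\in K[x]$ is disintegrated if it has degree $\delta\geq 2$ and is not linearly conjugate to $x^\delta$, $T_\delta(x)$ or $-T_\delta(x)$. $f^{\circ m}$ denotes the $m$-fold iterate of $f$. For polynomials $f,\eta\in K[x]$ of degree at least $2$, $\eta$ is said to be semiconjugate to $f$ if there is a non-constant polynomial $p\in K[x]$ such that $f\circ p=p\circ\eta$. For disintegrated polynomials $f,g\in K[x]$, write $f\approx g$ if there exist a positive integer $M$ and a polynomial in $K[x]$ that is semiconjugate to both $f^{\circ M}$ and $g^{\circ M}$. *)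

theory Defs
  imports "HOL-Computational_Algebra.Computational_Algebra"
begin

definition poly_iter :: "'a::comm_semiring_1 poly \<Rightarrow> nat \<Rightarrow> 'a poly"
  where "poly_iter f m = (pcompose f ^^ m) [:0, 1:]"

text \<open>
  The identity of rational functions \<open>T(x + 1/x) = x^\<delta> + 1/x^\<delta>\<close> is stated pointwise at the nonzero
  elements of the field. This is the same thing over an infinite field; existence and
  uniqueness over an algebraically closed field of characteristic 0 are shown in \<open>chebyshev_ex1\<close> below.
  Note that in this (Dickson) normalisation \<open>T\<close> is monic, with \<open>T\<^sub>2 = x^2 - 2\<close>.
\<close>

definition chebyshev :: "nat \<Rightarrow> 'a::field poly"
  where "chebyshev \<delta> =
    (THE T. degree T = \<delta> \<and> (\<forall>x. x \<noteq> 0 \<longrightarrow> poly T (x + 1 / x) = x ^ \<delta> + 1 / x ^ \<delta>))"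

text \<open>The polynomial \<open>l'\<close> is the compositional inverse of the linear polynomial \<open>l\<close>.\<close>

definition linearly_conjugate :: "'a::field poly \<Rightarrow> 'a poly \<Rightarrow> bool"
  where "linearly_conjugate f g \<longleftrightarrow>
    (\<exists>l l'. degree l = 1 \<and> pcompose l l' = [:0, 1:] \<and> pcompose l' l = [:0, 1:] \<and>
       g = pcompose l (pcompose f l'))"

definition disintegrated :: "'a::field poly \<Rightarrow> bool"
  where "disintegrated f \<longleftrightarrow> degree f \<ge> 2 \<and>
    \<not> linearly_conjugate f (monom 1 (degree f)) \<and>
    \<not> linearly_conjugate f (chebyshev (degree f)) \<and>
    \<not> linearly_conjugate f (- chebyshev (degree f))"

definition semiconjugate :: "'a::field poly \<Rightarrow> 'a poly \<Rightarrow> bool"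
  where "semiconjugate \<eta> f \<longleftrightarrow> degree \<eta> \<ge> 2 \<and> degree f \<ge> 2 \<and>
    (\<exists>p. degree p > 0 \<and> pcompose f p = pcompose p \<eta>)"

text \<open>The relation \<open>f \<approx> g\<close>; it is meant for disintegrated \<open>f\<close> and \<open>g\<close> only.\<close>

definition approx_rel :: "'a::field poly \<Rightarrow> 'a poly \<Rightarrow> bool"
  where "approx_rel f g \<longleftrightarrow>
    (\<exists>M>0. \<exists>\<eta>. semiconjugate \<eta> (poly_iter f M) \<and> semiconjugate \<eta> (poly_iter g M))"

fun cheb_rec :: "nat \<Rightarrow> 'a::field poly"
  where
    "cheb_rec 0 = [:2:]"
  | "cheb_rec (Suc 0) = [:0, 1:]"
  | "cheb_rec (Suc (Suc n)) = [:0, 1:] * cheb_rec (Suc n) - cheb_rec n"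

lemma poly_cheb_rec:
  fixes x :: "'a::field"
  assumes "x \<noteq> 0"
  shows "poly (cheb_rec n) (x + 1 / x) = x ^ n + 1 / x ^ n"
  using assms by (induction n rule: cheb_rec.induct) (auto simp: field_simps)

lemma degree_cheb_rec: "degree (cheb_rec n :: 'a::field poly) = n"
proof -
  have "degree (cheb_rec n :: 'a poly) = n \<and> degree (cheb_rec (Suc n) :: 'a poly) = Suc n"
  proof (induction n)
    case (Suc n)
    let ?p = "cheb_rec (Suc n) :: 'a poly" and ?q = "cheb_rec n :: 'a poly"
    have "?p \<noteq> 0" using Suc by force
    then have "degree ([:0, 1:] * ?p) = Suc (Suc n)"
      using Suc by simp
    moreover have "degree (- ?q) < degree ([:0, 1:] * ?p)"
      using Suc calculation by simp
    ultimately have "degree ([:0, 1:] * ?p + - ?q) = Suc (Suc n)"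
      by (metis degree_add_eq_left)
    then show ?case using Suc by simp
  qed auto
  then show ?thesis by blast
qed

lemma chebyshev_ex1:
  "\<exists>!T :: 'a::{alg_closed_field, field_char_0} poly.
     degree T = \<delta> \<and> (\<forall>x. x \<noteq> 0 \<longrightarrow> poly T (x + 1 / x) = x ^ \<delta> + 1 / x ^ \<delta>)"
proof (rule ex_ex1I)
  show "\<exists>T :: 'a poly.
     degree T = \<delta> \<and> (\<forall>x. x \<noteq> 0 \<longrightarrow> poly T (x + 1 / x) = x ^ \<delta> + 1 / x ^ \<delta>)"
    using poly_cheb_rec degree_cheb_rec by blast
next
  fix S T :: "'a poly"
  assume S: "degree S = \<delta> \<and> (\<forall>x. x \<noteq> 0 \<longrightarrow> poly S (x + 1 / x) = x ^ \<delta> + 1 / x ^ \<delta>)"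
    and T: "degree T = \<delta> \<and> (\<forall>x. x \<noteq> 0 \<longrightarrow> poly T (x + 1 / x) = x ^ \<delta> + 1 / x ^ \<delta>)"
  have "poly S y = poly T y" for y
  proof -
    obtain x where "poly [:1, - y, 1:] x = 0"
      using alg_closed_imp_poly_has_root[of "[:1, - y, 1:]"] by auto
    then have x: "1 + x * (x - y) = 0" by simp
    then have "x \<noteq> 0" by auto
    moreover have "y = x + 1 / x"
      using x \<open>x \<noteq> 0\<close> by (simp add: field_simps)
    ultimately show ?thesis using S T by simp
  qed
  then show "S = T" by (metis poly_eq_poly_eq_iff ext)
qed

lemma chebyshev_eq_cheb_rec: "(chebyshev \<delta> :: 'a::{alg_closed_field, field_char_0} poly) = cheb_rec \<delta>"
  unfolding chebyshev_def
  by (rule the1_equality[OF chebyshev_ex1]) (use poly_cheb_rec degree_cheb_rec in blast)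

end

theory Submission
  imports Defs
begin

text \<open>
  The degrees of \<open>f\<close> and \<open>g\<close> agree, and the argument produces an iterate \<open>N\<close> that is at most this
  common degree \<open>\<delta>\<close>. Write the hypothesis as \<open>f\<^sup>M \<circ> p = p \<circ> \<eta>\<close> and \<open>g\<^sup>M \<circ> q = q \<circ> \<eta>\<close>.

  First, the degrees of \<open>p\<close> and \<open>q\<close> are made coprime to \<open>\<delta>\<close>. A theorem of Ritt (\<open>ritt_lcm\<close>) shows that
  \<open>f\<close> and \<open>p\<close> have a common left factor \<open>U\<close> of degree \<open>gcd (deg p) \<delta>\<close>: say \<open>f = U \<circ> S\<close> and \<open>p = U \<circ> T\<close>.
  Then \<open>(S \<circ> U)\<^sup>M \<circ> T = T \<circ> \<eta>\<close> with the same \<open>\<eta>\<close>, while \<open>S \<circ> U\<close> is semiconjugate to \<open>f\<close> through \<open>U\<close>.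
  So \<open>f\<close> may be replaced by \<open>S \<circ> U\<close>, and since \<open>\<eta>\<close> is untouched the two sides can be treated
  separately (\<open>reduce_to_coprime\<close>). Being disintegrated is expressed by ramification data
  (\<open>cheb_like\<close>, \<open>power_like\<close>), which pass from \<open>S \<circ> U\<close> back to \<open>U \<circ> S\<close>.

  In the coprime case the curve \<open>f\<^sup>M(x) = p(y)\<close> is parametrised by \<open>t \<mapsto> (p(t), \<eta>(t))\<close>
  (\<open>fibre_product_parametrised\<close>). Comparing ramification along it shows that the set \<open>V\<close> of branch
  values of \<open>p\<close> is mapped into itself by \<open>f\<^sup>M\<close>, and that \<open>f\<^sup>M\<close> is ramified at every preimage of \<open>V\<close>
  outside \<open>V\<close>. A Riemann-Hurwitz count (\<open>cheb_like_criterion\<close>) leaves at most two points in such a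
  set, and two points occur only for conjugates of Chebyshev polynomials up to sign, a property that
  \<open>f\<close> would inherit from its iterate. Hence \<open>p\<close> has at most one branch value, so it is \<open>x\<^sup>a\<close> up to
  affine maps on both sides, and moreover \<open>f \<circ> p = p \<circ> \<psi>\<close> holds for a polynomial \<open>\<psi>\<close>
  already at the level of \<open>f\<close> itself (\<open>coprime_intertwiner_normal_form\<close>). Likewise
  \<open>g \<circ> q = q \<circ> \<theta>\<close>.

  Now \<open>\<eta>\<close> equals both \<open>\<psi>\<^sup>M\<close> and \<open>\<theta>\<^sup>M\<close> up to roots of unity of order prime to \<open>\<delta>\<close>. Once a translation
  has made the sum of the roots of \<open>\<eta>\<close> vanish, this forces \<open>\<psi> = \<omega>\<theta>\<close> and \<open>\<theta>(\<omega>x) = \<omega>\<^sup>\<delta>\<theta>(x)\<close>, hence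
  \<open>\<psi>\<^sup>N = \<omega>\<^sup>s\<theta>\<^sup>N\<close>, where \<open>s\<close> is the sum of the first \<open>N\<close> powers of \<open>\<delta>\<close>. As \<open>\<theta>\<close> is not
  a monomial, \<open>\<omega>\<close> has order at most \<open>\<delta>\<close>, and the pigeonhole principle yields some \<open>N \<le> \<delta>\<close> with
  \<open>\<psi>\<^sup>N = \<theta>\<^sup>N\<close> (\<open>common_iterate\<close>). This iterate is semiconjugate to both \<open>f\<^sup>N\<close> and \<open>g\<^sup>N\<close>.
\<close>

section \<open>Laurent series in the reciprocal of the variable\<close>

unbundle fps_syntax

definition fls_eval :: "'a::field poly \<Rightarrow> 'a fls \<Rightarrow> 'a fls"
  where "fls_eval p X = poly (map_poly fls_const p) X"

lemma fls_eval_pCons [simp]: "fls_eval (pCons c p) X = fls_const c + X * fls_eval p X"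
  unfolding fls_eval_def by (simp add: map_poly_pCons)

lemma fls_eval_0 [simp]: "fls_eval 0 X = 0"
  by (simp add: fls_eval_def)

lemma fls_eval_add: "fls_eval (p + q) X = fls_eval p X + fls_eval q X"
  by (induction p q rule: poly_induct2) (simp_all add: algebra_simps flip: fls_plus_const)

lemma fls_eval_smult: "fls_eval (smult c p) X = fls_const c * fls_eval p X"
  by (induction p) (simp_all add: algebra_simps)

lemma fls_eval_mult: "fls_eval (p * q) X = fls_eval p X * fls_eval q X"
  by (induction p) (simp_all add: algebra_simps fls_eval_add fls_eval_smult)

lemma fls_eval_diff: "fls_eval (p - q) X = fls_eval p X - fls_eval q X"
  using fls_eval_add[of "p - q" q X] by simp

lemma fls_eval_pcompose: "fls_eval (pcompose p q) X = fls_eval p (fls_eval q X)"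
  by (induction p) (simp_all add: pcompose_pCons fls_eval_add fls_eval_mult)

lemma fls_eval_fps:
  assumes "S $ 0 = 0"
  shows "fls_eval q (fps_to_fls S) = fps_to_fls (fps_of_poly q oo S)"
proof (induction q)
  case (pCons c q)
  have "fps_of_poly (pCons c q) oo S = fps_const c + S * (fps_of_poly q oo S)"
    using assms by (simp add: fps_of_poly_pCons fps_compose_add_distrib fps_compose_mult_distrib
      mult.commute)
  then show ?case by (simp add: pCons.IH fls_times_fps_to_fls)
qed simp

text \<open>
  The coefficient \<open>c\<close> may be zero. This lets leading terms be added and multiplied without case
  distinctions, and lets a term of higher order count as a zero coefficient.
\<close>

definition leading_term :: "'a::field fls \<Rightarrow> int \<Rightarrow> 'a \<Rightarrow> bool"
  where "leading_term F k c \<longleftrightarrow> (\<forall>j<k. F $$ j = 0) \<and> F $$ k = c"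

lemma leading_term_subdegree: "leading_term F k c \<Longrightarrow> F \<noteq> 0 \<Longrightarrow> k \<le> fls_subdegree F"
  by (auto simp: leading_term_def intro!: fls_subdegree_geI)

lemma leading_term_0: "leading_term 0 k 0"
  by (simp add: leading_term_def)

lemma leading_term_const: "leading_term (fls_const c) 0 c"
  by (simp add: leading_term_def)

lemma leading_term_mult:
  assumes "leading_term F k c" "leading_term G l d"
  shows "leading_term (F * G) (k + l) (c * d)"
proof (cases "F = 0 \<or> G = 0")
  case True
  then show ?thesis using assms by (auto simp: leading_term_def)
next
  case False
  then have k: "k \<le> fls_subdegree F" and l: "l \<le> fls_subdegree G"
    using assms leading_term_subdegree by blast+
  have "(F * G) $$ j = 0" if "j < k + l" for j
    using that k l by (intro fls_times_nth_eq0) simp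
  moreover have "(F * G) $$ (k + l) = c * d"
  proof (cases "k + l = fls_subdegree F + fls_subdegree G")
    case True
    then have "k = fls_subdegree F" "l = fls_subdegree G" using k l by auto
    then show ?thesis using assms fls_times_base[of F G] by (simp add: leading_term_def)
  next
    case neq: False
    then have "c = 0 \<or> d = 0"
      using assms k l unfolding leading_term_def
      by (metis fls_eq0_below_subdegree order_le_less)
    then show ?thesis using neq k l by (auto intro!: fls_times_nth_eq0)
  qed
  ultimately show ?thesis by (simp add: leading_term_def)
qed

lemma leading_term_power: "leading_term F k c \<Longrightarrow> leading_term (F ^ n) (int n * k) (c ^ n)"
proof (induction n)
  case 0
  show ?case by (simp add: leading_term_def)
next
  case (Suc n)
  then have "leading_term (F * F ^ n) (k + int n * k) (c * c ^ n)"
    by (intro leading_term_mult)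
  moreover have "k + int n * k = int (Suc n) * k" by (simp add: algebra_simps)
  ultimately show ?case by simp
qed

lemma leading_term_add: "leading_term F k c \<Longrightarrow> leading_term G k d \<Longrightarrow> leading_term (F + G) k (c + d)"
  by (simp add: leading_term_def)

lemma leading_term_sum:
  "(\<And>i. i \<in> A \<Longrightarrow> leading_term (F i) k (c i)) \<Longrightarrow> leading_term (sum F A) k (sum c A)"
  by (induction A rule: infinite_finite_induct) (auto intro: leading_term_0 leading_term_add)

lemma leading_term_weaken: "leading_term F k c \<Longrightarrow> l < k \<Longrightarrow> leading_term F l 0"
  by (simp add: leading_term_def)

lemma leading_term_eval:
  assumes "leading_term Y (- int a) y" "a > 0"
  shows "leading_term (fls_eval p Y) (- int (degree p * a)) (lead_coeff p * y ^ degree p)"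
proof (induction p)
  case 0
  show ?case by (simp add: leading_term_0)
next
  case (pCons c p)
  show ?case
  proof (cases "p = 0")
    case True
    then show ?thesis by (simp add: leading_term_def)
  next
    case False
    have "leading_term (Y * fls_eval p Y) (- int a + - int (degree p * a)) (y * (lead_coeff p * y ^ degree p))"
      by (rule leading_term_mult[OF assms(1) pCons.IH])
    moreover have "leading_term (fls_const c) (- int a + - int (degree p * a)) 0"
    proof (rule leading_term_weaken[OF leading_term_const])
      have "0 \<le> int (degree p * a)" by (rule of_nat_0_le_iff)
      then show "- int a + - int (degree p * a) < 0" using assms(2) by linarith
    qed
    ultimately have "leading_term (fls_const c + Y * fls_eval p Y) (- int a + - int (degree p * a))
       (0 + y * (lead_coeff p * y ^ degree p))"
      by (intro leading_term_add)
    then show ?thesis using False by (simp add: algebra_simps)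
  qed
qed

definition fls_exponents_dvd :: "nat \<Rightarrow> 'a::field fls \<Rightarrow> bool"
  where "fls_exponents_dvd a F \<longleftrightarrow> (\<forall>k. F $$ k \<noteq> 0 \<longrightarrow> int a dvd k)"

lemma fls_exponents_dvd_const: "fls_exponents_dvd a (fls_const c)"
  by (simp add: fls_exponents_dvd_def)

lemma fls_exponents_dvd_add: "fls_exponents_dvd a F \<Longrightarrow> fls_exponents_dvd a G \<Longrightarrow> fls_exponents_dvd a (F + G)"
  unfolding fls_exponents_dvd_def by (metis fls_plus_nth add.right_neutral)

lemma fls_exponents_dvd_diff: "fls_exponents_dvd a F \<Longrightarrow> fls_exponents_dvd a G \<Longrightarrow> fls_exponents_dvd a (F - G)"
  unfolding fls_exponents_dvd_def by (metis fls_minus_nth diff_0_right)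

lemma fls_exponents_dvd_mult:
  assumes "fls_exponents_dvd a F" "fls_exponents_dvd a G"
  shows "fls_exponents_dvd a (F * G)"
  unfolding fls_exponents_dvd_def
proof (intro allI impI)
  fix k assume "(F * G) $$ k \<noteq> 0"
  then obtain i where "F $$ i * G $$ (k - i) \<noteq> 0"
    unfolding fls_times_nth(2) by (meson sum.not_neutral_contains_not_neutral)
  then have "int a dvd i" "int a dvd (k - i)"
    using assms by (auto simp: fls_exponents_dvd_def)
  then show "int a dvd k" using dvd_add by fastforce
qed

lemma fls_exponents_dvd_eval: "fls_exponents_dvd a Y \<Longrightarrow> fls_exponents_dvd a (fls_eval p Y)"
  by (induction p) (auto intro: fls_exponents_dvd_add fls_exponents_dvd_mult fls_exponents_dvd_const
     simp: fls_exponents_dvd_def[of _ 0])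

text \<open>
  A divided difference: the second factor replaces the derivative of \<open>p\<close>, and its leading term
  can be read off when \<open>Y\<close> and \<open>Z\<close> have the same leading term.
\<close>

lemma fls_eval_difference:
  "fls_eval p Y - fls_eval p Z =
    (Y - Z) * (\<Sum>i\<le>degree p. fls_const (coeff p i) * (\<Sum>j<i. Y ^ j * Z ^ (i - Suc j)))"
proof -
  have ev: "fls_eval p W = (\<Sum>i\<le>degree p. fls_const (coeff p i) * W ^ i)" for W
    unfolding fls_eval_def poly_altdef
    by (subst degree_map_poly) (auto simp: coeff_map_poly)
  have "W ^ i - V ^ i = (W - V) * (\<Sum>j<i. W ^ j * V ^ (i - Suc j))" for W V :: "'a fls" and i
    using power_diff_sumr2[of W i V] by (simp add: mult.commute)
  then show ?thesis
    by (simp add: ev sum_distrib_left mult.left_commute flip: sum_subtractf right_diff_distrib)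
qed

text \<open>
  If \<open>Y\<close> had exponents outside the multiples of \<open>a\<close>, let \<open>m\<close> be the first of them and let \<open>Z\<close> be the
  part of \<open>Y\<close> with exponents divisible by \<open>a\<close>. The difference \<open>p(Y) - p(Z)\<close> behaves to leading order
  like \<open>(Y - Z) p'(Y)\<close>, so it starts at \<open>m\<close> shifted by a multiple of \<open>a\<close>, whereas all its exponents
  are multiples of \<open>a\<close>. Characteristic zero keeps the leading coefficient of \<open>p'\<close> from vanishing.
\<close>

lemma fls_exponents_dvd_of_eval:
  fixes Y :: "'a::field_char_0 fls"
  assumes Y: "leading_term Y (- int a) y" "y \<noteq> 0" "a > 0" and deg: "degree p > 0"
    and ev: "fls_exponents_dvd a (fls_eval p Y)"
  shows "fls_exponents_dvd a Y"
proof (rule ccontr)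
  assume bad: "\<not> fls_exponents_dvd a Y"
  define Z where "Z = Abs_fls (\<lambda>k. if int a dvd k then Y $$ k else 0)"
  have Z: "Z $$ k = (if int a dvd k then Y $$ k else 0)" for k
    unfolding Z_def
    by (rule nth_Abs_fls_lower_bound[where N = "- int a"]) (use Y in \<open>auto simp: leading_term_def\<close>)
  have Za: "fls_exponents_dvd a Z" by (auto simp: fls_exponents_dvd_def Z split: if_splits)
  have ltZ: "leading_term Z (- int a) y" using Y by (auto simp: leading_term_def Z)
  have "Y - Z \<noteq> 0" using bad Za by auto
  define m where "m = fls_subdegree (Y - Z)"
  define z where "z = (Y - Z) $$ m"
  have z: "z \<noteq> 0" unfolding z_def m_def using \<open>Y - Z \<noteq> 0\<close> by (rule nth_fls_subdegree_nonzero)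
  then have m: "\<not> int a dvd m" unfolding z_def by (auto simp: Z)
  have lt1: "leading_term (Y - Z) m z"
    unfolding leading_term_def z_def m_def using fls_eq0_below_subdegree[of _ "Y - Z"] by blast
  let ?d = "degree p"
  let ?k = "- int ((?d - 1) * a)"
  let ?G = "\<lambda>i. fls_const (coeff p i) * (\<Sum>j<i. Y ^ j * Z ^ (i - Suc j))"
  have ltG: "leading_term (?G i) (- int ((i - 1) * a)) (coeff p i * (of_nat i * y ^ (i - 1)))" for i
  proof -
    have "leading_term (\<Sum>j<i. Y ^ j * Z ^ (i - Suc j)) (- int ((i - 1) * a)) (\<Sum>j<i. y ^ (i - 1))"
    proof (rule leading_term_sum)
      fix j assume "j \<in> {..<i}"
      then have j: "i - 1 = j + (i - Suc j)" by simp
      have "leading_term (Y ^ j * Z ^ (i - Suc j)) (int j * (- int a) + int (i - Suc j) * (- int a))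
          (y ^ j * y ^ (i - Suc j))"
        by (intro leading_term_mult leading_term_power Y ltZ)
      moreover have "int j * (- int a) + int (i - Suc j) * (- int a) = - int ((i - 1) * a)"
        unfolding j by (simp only: of_nat_mult of_nat_add) (simp add: algebra_simps)
      ultimately show "leading_term (Y ^ j * Z ^ (i - Suc j)) (- int ((i - 1) * a)) (y ^ (i - 1))"
        unfolding j power_add by simp
    qed
    from leading_term_mult[OF leading_term_const this] show ?thesis by simp
  qed
  have "leading_term (\<Sum>i\<le>?d. ?G i) ?k (\<Sum>i\<le>?d. if i = ?d then coeff p i * (of_nat i * y ^ (i - 1)) else 0)"
  proof (rule leading_term_sum)
    fix i assume "i \<in> {..?d}"
    show "leading_term (?G i) ?k (if i = ?d then coeff p i * (of_nat i * y ^ (i - 1)) else 0)"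
    proof (cases "i = ?d")
      case True
      then show ?thesis using ltG[of i] by simp
    next
      case False
      then have "i < ?d" using \<open>i \<in> {..?d}\<close> by simp
      show ?thesis
      proof (cases "i = 0")
        case True
        then show ?thesis using False by (simp add: leading_term_0)
      next
        case i0: False
        then have "(i - 1) * a < (?d - 1) * a" using \<open>i < ?d\<close> \<open>a > 0\<close> by (intro mult_less_mono1) auto
        then have "?k < - int ((i - 1) * a)" by linarith
        from leading_term_weaken[OF ltG this] show ?thesis using False by simp
      qed
    qed
  qed
  then have "leading_term (\<Sum>i\<le>?d. ?G i) ?k (lead_coeff p * (of_nat ?d * y ^ (?d - 1)))"
    by simp
  from leading_term_mult[OF lt1 this]
  have "leading_term (fls_eval p Y - fls_eval p Z) (m + ?k) (z * (lead_coeff p * (of_nat ?d * y ^ (?d - 1))))"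
    unfolding fls_eval_difference .
  moreover have "z * (lead_coeff p * (of_nat ?d * y ^ (?d - 1))) \<noteq> 0"
    using z Y deg by auto
  ultimately have "(fls_eval p Y - fls_eval p Z) $$ (m + ?k) \<noteq> 0"
    by (auto simp: leading_term_def)
  moreover have "fls_exponents_dvd a (fls_eval p Y - fls_eval p Z)"
    by (intro fls_exponents_dvd_diff ev fls_exponents_dvd_eval Za)
  ultimately have "int a dvd m + ?k" by (auto simp: fls_exponents_dvd_def)
  moreover have "int a dvd ?k" by simp
  ultimately have "int a dvd m" using dvd_add_left_iff by blast
  then show False using m by contradiction
qed

text \<open>
  The variable of the series is the reciprocal of an \<open>n\<close>-th root of \<open>h\<close> near infinity, and \<open>X\<close> expresses
  the coordinate through it. For \<open>s = 1/X\<close> the equation says that \<open>s\<close> equals the variable times an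
  \<open>n\<close>-th root of the normalised reversed polynomial of \<open>h\<close> at \<open>s\<close>. The root exists in characteristic zero, and the equation is solved for \<open>s\<close>
  by the compositional inverse of a power series.
\<close>

lemma ex_parameter_at_infinity:
  fixes h :: "'a::field_char_0 poly"
  assumes "degree h > 0"
  shows "\<exists>X. leading_term X (-1) 1 \<and> fls_eval h X = fls_const (lead_coeff h) * fls_X_inv ^ degree h"
proof -
  define n where "n = degree h"
  define c where "c = lead_coeff h"
  have n: "n > 0" "Suc (n - 1) = n" and c: "c \<noteq> 0" using assms unfolding n_def c_def by auto
  define H where "H = fps_of_poly (smult (inverse c) (reflect_poly h))"
  have H0: "H $ 0 = 1" using c by (simp add: H_def c_def)
  define r where "r = fps_radical (\<lambda>_ x. x) n H"
  have r0: "r $ 0 = 1" using n by (simp add: r_def H0)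
  have rn: "r ^ n = H"
    using power_radical[of H "\<lambda>_ x. x" "n - 1"] n by (simp add: H0 r_def)
  define q where "q = fps_X * inverse r"
  have q: "q $ 0 = 0" "q $ 1 \<noteq> 0" using r0 by (simp_all add: q_def)
  define S where "S = fps_inv q"
  have S0: "S $ 0 = 0" by (simp add: S_def fps_inv_def)
  have rS0: "(r oo S) $ 0 = 1" by (simp add: r0)
  have "fps_X = q oo S" using fps_inv_right[OF q] by (simp add: S_def)
  also have "\<dots> = S * inverse (r oo S)"
    using S0 r0 by (simp add: q_def fps_compose_mult_distrib fps_X_fps_compose_startby0 fps_inverse_compose)
  finally have "fps_X * (r oo S) = S * (inverse (r oo S) * (r oo S))"
    by (simp add: mult.assoc)
  moreover have "inverse (r oo S) * (r oo S) = 1"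
    by (rule inverse_mult_eq_1) (simp add: r0)
  ultimately have S: "S = fps_X * (r oo S)"
    by (simp only: mult_1_right)
  define s where "s = fps_to_fls S"
  define R where "R = fps_to_fls (r oo S)"
  have s: "s = fls_X * R"
    unfolding s_def R_def by (subst S) (simp add: fls_times_fps_to_fls)
  have R0: "R \<noteq> 0" unfolding R_def using rS0 by (metis fps_nonzeroI fps_to_fls_eq_0_iff zero_neq_one)
  then have s0: "s \<noteq> 0" by (simp add: s)
  define X where "X = inverse s"
  have "fls_eval h X * s ^ n = fls_eval (reflect_poly h) s"
  proof -
    have "reflect_poly (map_poly fls_const h) = map_poly fls_const (reflect_poly h)"
      by (rule poly_eqI) (simp add: coeff_reflect_poly coeff_map_poly degree_map_poly)
    moreover have "degree (map_poly fls_const h) = n"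
      by (simp add: degree_map_poly n_def)
    ultimately show ?thesis
      using poly_reflect_poly_nz[OF s0, of "map_poly fls_const h"]
      by (simp add: fls_eval_def X_def mult.commute)
  qed
  also have "reflect_poly h = smult c (smult (inverse c) (reflect_poly h))" using c by simp
  also have "fls_eval \<dots> s = fls_const c * fps_to_fls (H oo S)"
    by (subst fls_eval_smult) (simp only: s_def fls_eval_fps[OF S0] H_def)
  also have "H oo S = (r oo S) ^ n" by (simp add: fps_compose_power[OF S0] flip: rn)
  also have "fps_to_fls \<dots> = R ^ n" by (simp add: R_def fps_to_fls_power)
  finally have "fls_eval h X * fls_X ^ n * R ^ n = fls_const c * R ^ n"
    by (simp add: s power_mult_distrib mult.assoc)
  then have "fls_eval h X * fls_X ^ n = fls_const c" using R0 by simp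
  then have "fls_eval h X * (fls_X ^ n * fls_X_inv ^ n) = fls_const c * fls_X_inv ^ n"
    by (simp only: flip: mult.assoc)
  moreover have "fls_X ^ n * fls_X_inv ^ n = (1 :: 'a fls)"
    by (simp flip: power_mult_distrib add: fls_X_times_conv_shift)
  ultimately have "fls_eval h X = fls_const c * fls_X_inv ^ n"
    by simp
  moreover have "leading_term X (-1) 1"
  proof -
    have sd: "fls_subdegree s = 1"
      by (rule fls_subdegree_eqI) (use q in \<open>auto simp: s R_def fls_X_times_conv_shift r0\<close>)
    have "fls_subdegree X = - 1" using s0 sd by (simp add: X_def)
    moreover have "X $$ (-1) = 1"
    proof -
      have "X * s = 1" using s0 by (simp add: X_def)
      then have "X $$ (-1) * s $$ 1 = 1"
        using fls_times_base[of X s] sd calculation by simp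
      moreover have "s $$ 1 = 1" by (simp add: s R_def fls_X_times_conv_shift r0)
      ultimately show ?thesis by simp
    qed
    ultimately show ?thesis by (simp add: leading_term_def)
  qed
  ultimately show ?thesis by (intro exI[of _ X]) (simp add: n_def c_def)
qed

text \<open>
  Substituting the parameter of \<open>A \<circ> P = B \<circ> Q\<close> turns \<open>P\<close> into a series whose exponents are all
  divisible by \<open>deg P\<close>, because \<open>A\<close> maps it to a monomial, and similarly \<open>Q\<close>. Every
  exponent in a combination \<open>C \<circ> P - E \<circ> Q\<close> is therefore divisible by one of the two degrees, in
  particular the leading one, which is the degree of the combination.
\<close>

lemma degree_diff_pcompose_dvd:
  fixes P Q :: "'a::field_char_0 poly"
  assumes AB: "pcompose A P = pcompose B Q"
    and pos: "degree A > 0" "degree P > 0" "degree B > 0" "degree Q > 0"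
    and "pcompose C P - pcompose E Q \<noteq> 0"
  shows "degree P dvd degree (pcompose C P - pcompose E Q) \<or> degree Q dvd degree (pcompose C P - pcompose E Q)"
proof -
  define h where "h = pcompose A P"
  have h: "h = pcompose B Q" "degree h = degree A * degree P" "degree h = degree B * degree Q"
    using AB by (metis h_def, metis h_def degree_pcompose, metis h_def degree_pcompose)
  obtain X where X: "leading_term X (-1) 1"
    and hX: "fls_eval h X = fls_const (lead_coeff h) * fls_X_inv ^ degree h"
    using ex_parameter_at_infinity[of h] h pos by auto
  have lt: "leading_term (fls_eval p X) (- int (degree p)) (lead_coeff p)" for p
    using leading_term_eval[of X 1 1 p] X by simp
  have hin: "fls_exponents_dvd a (fls_eval h X)" if "a dvd degree h" for a
    unfolding hX by (intro fls_exponents_dvd_mult fls_exponents_dvd_const) (use that in \<open>simp add: fls_exponents_dvd_def\<close>)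
  have "P \<noteq> 0" "Q \<noteq> 0" using pos by auto
  have P: "fls_exponents_dvd (degree P) (fls_eval P X)"
    by (rule fls_exponents_dvd_of_eval[OF lt _ _ pos(1)])
       (use pos \<open>P \<noteq> 0\<close> hin[of "degree P"] h(2) in \<open>simp_all add: h_def flip: fls_eval_pcompose\<close>)
  have Q: "fls_exponents_dvd (degree Q) (fls_eval Q X)"
    by (rule fls_exponents_dvd_of_eval[OF lt _ _ pos(3)])
       (use pos \<open>Q \<noteq> 0\<close> hin[of "degree Q"] h(1,3) in \<open>simp_all flip: fls_eval_pcompose\<close>)
  let ?R = "pcompose C P - pcompose E Q"
  have "fls_eval ?R X $$ (- int (degree ?R)) \<noteq> 0"
    using lt[of ?R] assms(6) leading_coeff_0_iff[of ?R] unfolding leading_term_def by (metis right_minus_eq)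
  then have "fls_eval (pcompose C P) X $$ (- int (degree ?R)) \<noteq> 0 \<or>
      fls_eval (pcompose E Q) X $$ (- int (degree ?R)) \<noteq> 0"
    by (auto simp: fls_eval_diff)
  then show ?thesis
    using fls_exponents_dvd_eval[OF P, of C] fls_exponents_dvd_eval[OF Q, of E]
    by (auto simp: fls_exponents_dvd_def fls_eval_pcompose)
qed

unbundle no fps_syntax

section \<open>Left factors of composite polynomials\<close>

lemma pcompose_power: "pcompose (p ^ n) q = pcompose p q ^ n"
  for q :: "'a::comm_semiring_1 poly"
  by (induction n) (simp_all add: pcompose_mult pcompose_1)

lemma pcompose_monom: "pcompose (monom c n) q = smult c (q ^ n)"
  for q :: "'a::comm_semiring_1 poly"
  by (induction n) (simp_all add: monom_0 monom_Suc pcompose_pCons)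

lemma pcompose_right_cancel:
  fixes p :: "'a::idom poly"
  assumes "degree p > 0" "pcompose C p = pcompose E p"
  shows "C = E"
  using assms pcompose_eq_0[of "C - E" p] by (simp add: pcompose_diff)

lemma degree_diff_less_of_coeff_eq:
  fixes p q :: "'a::ab_group_add poly"
  assumes "degree p \<le> n" "degree q \<le> n" "coeff p n = coeff q n" "p \<noteq> q"
  shows "degree (p - q) < n"
proof (rule ccontr)
  assume "\<not> degree (p - q) < n"
  then have "degree (p - q) = n" using degree_diff_le[OF assms(1,2)] by simp
  then have "coeff (p - q) n \<noteq> 0" using assms(4) by (metis leading_coeff_0_iff right_minus_eq)
  then show False using assms(3) by simp
qed

lemma coeff_power_degree: "coeff (p ^ n) (n * degree p) = lead_coeff p ^ n"
  for p :: "'a::idom poly"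
  using lead_coeff_power[of p n] degree_power_eq[of p n] by (cases "p = 0"; cases n) auto

lemma degree_diff_monom:
  fixes C :: "'a::ab_group_add poly"
  assumes "k < degree C" shows "degree (C - monom c k) = degree C"
proof -
  have "degree (- monom c k) < degree C" using assms degree_monom_le[of c k] by simp
  then show ?thesis using degree_add_eq_left[of "- monom c k" C] by simp
qed

text \<open>
  The leading term of \<open>C \<circ> P - E \<circ> Q\<close> can be cancelled by a power of \<open>P\<close> or by a power of \<open>Q\<close>. The power
  is smaller than the degree of \<open>C\<close> or \<open>E\<close>, so these degrees survive, and the descent ends with
  \<open>C \<circ> P = E \<circ> Q\<close>.
\<close>

lemma lcm_descent:
  fixes P Q :: "'a::field_char_0 poly"
  assumes AB: "pcompose A P = pcompose B Q"
    and pos: "degree A > 0" "degree P > 0" "degree B > 0" "degree Q > 0"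
    and "degree C = m" "degree E = n" "m * degree P = L" "n * degree Q = L"
    and "pcompose C P = pcompose E Q \<or> degree (pcompose C P - pcompose E Q) < L"
  shows "\<exists>S T. degree S = m \<and> degree T = n \<and> pcompose S P = pcompose T Q"
  using assms(6-10)
proof (induction "if pcompose C P = pcompose E Q then 0 else Suc (degree (pcompose C P - pcompose E Q))"
    arbitrary: C E rule: less_induct)
  case less
  let ?R = "pcompose C P - pcompose E Q"
  show ?case
  proof (cases "pcompose C P = pcompose E Q")
    case True
    then show ?thesis using less.prems by blast
  next
    case False
    then have R: "?R \<noteq> 0" and Rdeg: "degree ?R < L" using less.prems(5) by auto
    have smaller: "(if pcompose C' P = pcompose E' Q then 0 else Suc (degree (pcompose C' P - pcompose E' Q)))
      < (if pcompose C P = pcompose E Q then 0 else Suc (degree ?R)) \<and>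
      (pcompose C' P = pcompose E' Q \<or> degree (pcompose C' P - pcompose E' Q) < L)"
      if "pcompose C' P - pcompose E' Q = ?R - smult (lead_coeff ?R / lead_coeff W ^ k) (W ^ k)"
        "degree ?R = k * degree W" "W \<noteq> 0" for C' E' W k
    proof (cases "pcompose C' P = pcompose E' Q")
      case True
      then show ?thesis using False by simp
    next
      case ne: False
      have "degree (?R - smult (lead_coeff ?R / lead_coeff W ^ k) (W ^ k)) < degree ?R"
      proof (rule degree_diff_less_of_coeff_eq)
        show "degree (smult (lead_coeff ?R / lead_coeff W ^ k) (W ^ k)) \<le> degree ?R"
          using that by (simp add: degree_power_eq)
        have "coeff (W ^ k) (degree ?R) = lead_coeff W ^ k"
          unfolding that(2) by (rule coeff_power_degree)
        then show "lead_coeff ?R = coeff (smult (lead_coeff ?R / lead_coeff W ^ k) (W ^ k)) (degree ?R)"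
          using that(3) by simp
      qed (use ne that(1) in auto)
      then show ?thesis using ne False Rdeg that(1) by auto
    qed
    from degree_diff_pcompose_dvd[OF AB pos R]
    consider k where "degree ?R = k * degree P" | k where "degree ?R = k * degree Q"
      by (metis dvd_def mult.commute)
    then show ?thesis
    proof cases
      case 1
      define C' where "C' = C - monom (lead_coeff ?R / lead_coeff P ^ k) k"
      have "k < m" using 1 Rdeg less.prems(3) by (metis mult_less_cancel2)
      then have "degree C' = m" unfolding C'_def using less.prems(1) degree_diff_monom by metis
      moreover have "pcompose C' P - pcompose E Q = ?R - smult (lead_coeff ?R / lead_coeff P ^ k) (P ^ k)"
        by (simp add: C'_def pcompose_diff pcompose_monom)
      then have "(if pcompose C' P = pcompose E Q then 0 else Suc (degree (pcompose C' P - pcompose E Q)))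
        < (if pcompose C P = pcompose E Q then 0 else Suc (degree ?R)) \<and>
        (pcompose C' P = pcompose E Q \<or> degree (pcompose C' P - pcompose E Q) < L)"
        by (rule smaller) (use 1 pos in auto)
      ultimately show ?thesis using less.hyps[of C' E] less.prems by blast
    next
      case 2
      define c where "c = lead_coeff ?R / lead_coeff Q ^ k"
      define E' where "E' = E - monom (- c) k"
      have "k < n" using 2 Rdeg less.prems(4) by (metis mult_less_cancel2)
      then have "degree E' = n" unfolding E'_def using less.prems(2) degree_diff_monom by metis
      moreover have "pcompose C P - pcompose E' Q = ?R - smult (lead_coeff ?R / lead_coeff Q ^ k) (Q ^ k)"
        unfolding c_def[symmetric] by (simp add: E'_def pcompose_diff pcompose_monom)
      then have "(if pcompose C P = pcompose E' Q then 0 else Suc (degree (pcompose C P - pcompose E' Q)))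
        < (if pcompose C P = pcompose E Q then 0 else Suc (degree ?R)) \<and>
        (pcompose C P = pcompose E' Q \<or> degree (pcompose C P - pcompose E' Q) < L)"
        by (rule smaller) (use 2 pos in auto)
      ultimately show ?thesis using less.hyps[of C E'] less.prems by blast
    qed
  qed
qed

text \<open>
  Ritt's theorem in the language of rings: the intersection of \<open>K[P]\<close> and \<open>K[Q]\<close>, if it is not \<open>K\<close>, is
  generated by one polynomial \<open>S \<circ> P = T \<circ> Q\<close> whose degree is the least common multiple. The descent
  above yields the generator. Every element of the intersection has a degree divisible by that
  least common multiple, so subtracting powers of the generator expresses it as a polynomial in it.
\<close>

lemma ritt_lcm:
  fixes P Q :: "'a::field_char_0 poly"
  assumes AB: "pcompose A P = pcompose B Q"
    and pos: "degree A > 0" "degree P > 0" "degree B > 0" "degree Q > 0"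
  shows "\<exists>U S T. A = pcompose U S \<and> B = pcompose U T \<and> pcompose S P = pcompose T Q \<and>
     degree S = degree Q div gcd (degree P) (degree Q) \<and>
     degree T = degree P div gcd (degree P) (degree Q)"
proof -
  define a b where "a = degree P" and "b = degree Q"
  define m n where "m = b div gcd a b" and "n = a div gcd a b"
  have ab: "a > 0" "b > 0" using pos by (auto simp: a_def b_def)
  have mn: "m * a = n * b" "n > 0" "m > 0"
  proof -
    show "m * a = n * b" unfolding m_def n_def
      by (metis dvd_div_mult gcd_dvd1 gcd_dvd2 mult.commute)
    show "n > 0" "m > 0" unfolding m_def n_def using ab
      by (simp_all add: div_greater_zero_iff gcd_le1_nat gcd_le2_nat)
  qed
  have cop: "coprime m n" unfolding m_def n_def using ab div_gcd_coprime[of b a] by (simp add: gcd.commute)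
  \<comment> \<open>The starting pair of the descent consists of two powers whose leading terms agree.\<close>
  define c where "c = lead_coeff P ^ m / lead_coeff Q ^ n"
  have c: "c \<noteq> 0" unfolding c_def using pos by (auto simp: c_def)
  have "\<exists>S T. degree S = m \<and> degree T = n \<and> pcompose S P = pcompose T Q"
  proof (rule lcm_descent[OF AB pos, where C = "monom 1 m" and E = "monom c n" and L = "m * a"])
    have "degree (pcompose (monom 1 m) P - pcompose (monom c n) Q) < m * a"
      if "pcompose (monom 1 m) P \<noteq> pcompose (monom c n) Q"
    proof (rule degree_diff_less_of_coeff_eq)
      have "coeff (P ^ m) (m * a) = lead_coeff P ^ m" "coeff (Q ^ n) (n * b) = lead_coeff Q ^ n"
        unfolding a_def b_def by (rule coeff_power_degree)+
      then show "coeff (pcompose (monom 1 m) P) (m * a) = coeff (pcompose (monom c n) Q) (m * a)"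
        unfolding mn(1) using pos by (auto simp: pcompose_monom c_def mn(1))
    qed (use mn c that in \<open>auto simp: degree_pcompose degree_monom_eq a_def b_def\<close>)
    then show "pcompose (monom 1 m) P = pcompose (monom c n) Q \<or>
      degree (pcompose (monom 1 m) P - pcompose (monom c n) Q) < m * a" by blast
  qed (use mn c in \<open>auto simp: degree_monom_eq a_def b_def\<close>)
  then obtain S T where ST: "degree S = m" "degree T = n" "pcompose S P = pcompose T Q" by blast
  have "\<exists>U. C = pcompose U S" if "pcompose C P = pcompose E Q" for C E
    using that
  proof (induction "degree C" arbitrary: C E rule: less_induct)
    case less
    show ?case
    proof (cases "degree C = 0")
      case True
      then show ?thesis by (metis degree_0_id pcompose_const)
    next
      case False
      have "degree C * a = degree E * b"
        using less.prems by (metis a_def b_def degree_pcompose)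
      then have "degree C * n * gcd a b = degree E * m * gcd a b"
        by (simp add: m_def n_def mult.assoc)
      then have "degree C * n = degree E * m" using ab by simp
      then have "m dvd degree C" using cop by (metis coprime_dvd_mult_left_iff dvd_triv_right)
      then obtain k where k: "degree C = k * m" by (metis dvd_def mult.commute)
      define d where "d = lead_coeff C / lead_coeff S ^ k"
      define C' E' where "C' = C - smult d (S ^ k)" and "E' = E - smult d (T ^ k)"
      have "pcompose C' P = pcompose E' Q"
        by (simp add: C'_def E'_def pcompose_diff pcompose_smult pcompose_power less.prems ST)
      moreover have "C' = 0 \<or> degree C' < degree C"
      proof (cases "C = smult d (S ^ k)")
        case ne: False
        have "degree C' < degree C" unfolding C'_def
        proof (rule degree_diff_less_of_coeff_eq)
          have "S \<noteq> 0" using mn ST by auto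
          moreover have "coeff (S ^ k) (degree C) = lead_coeff S ^ k"
            unfolding k using coeff_power_degree[of S k] ST by simp
          ultimately show "lead_coeff C = coeff (smult d (S ^ k)) (degree C)" by (simp add: d_def)
          show "degree (smult d (S ^ k)) \<le> degree C" using ST k degree_power_le[of S k]
            by (simp add: degree_smult_le mult.commute)
        qed (use ne in auto)
        then show ?thesis ..
      qed (simp add: C'_def)
      then have "degree C' < degree C" using False by auto
      ultimately obtain U where U: "C' = pcompose U S" using less.hyps by blast
      have "C = pcompose (U + monom d k) S"
        using U by (simp add: C'_def pcompose_add pcompose_monom algebra_simps)
      then show ?thesis ..
    qed
  qed
  then obtain U where U: "A = pcompose U S" using AB by blast
  have "pcompose B Q = pcompose (pcompose U T) Q"
    by (metis AB U ST(3) pcompose_assoc)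
  then have "B = pcompose U T" using pcompose_right_cancel pos by blast
  then show ?thesis using U ST unfolding m_def n_def a_def b_def by blast
qed

text \<open>
  A right factor of a polynomial is determined by its degree up to an affine map: here the least
  common multiple is the degree itself, and \<open>S\<close> and \<open>T\<close> are affine.
\<close>

lemma ritt_same_degree:
  fixes P Q :: "'a::field_char_0 poly"
  assumes AB: "pcompose A P = pcompose B Q"
    and pos: "degree A > 0" "degree P > 0" and eq: "degree P = degree Q"
  shows "\<exists>l k. l \<noteq> 0 \<and> P = smult l Q + [:k:]"
proof -
  have "degree B > 0" using AB pos eq
    by (metis degree_pcompose gr0I mult_0 mult_is_0 not_gr_zero)
  then obtain S T where ST: "pcompose S P = pcompose T Q" "degree S = 1" "degree T = 1"
    using ritt_lcm[OF AB] pos eq by auto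
  obtain s0 s1 where S: "S = [:s0, s1:]" "s1 \<noteq> 0" using ST(2) by (metis degree1_coeffs)
  obtain t0 t1 where T: "T = [:t0, t1:]" "t1 \<noteq> 0" using ST(3) by (metis degree1_coeffs)
  have "[:s0:] + smult s1 P = [:t0:] + smult t1 Q"
    using ST(1) by (simp add: S T pcompose_pCons mult.commute)
  moreover have "p = q + (t - u)" if "u + p = t + q" for u p t q :: "'a poly"
    using that by (simp add: algebra_simps)
  ultimately have "smult s1 P = smult t1 Q + ([:t0:] - [:s0:])" by blast
  then have "smult (inverse s1) (smult s1 P) = smult (inverse s1) (smult t1 Q + ([:t0:] - [:s0:]))"
    by (rule arg_cong)
  also have "\<dots> = smult (t1 / s1) Q + [:(t0 - s0) / s1:]"
    by (simp add: smult_add_right divide_inverse mult.commute)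
  finally have "P = smult (t1 / s1) Q + [:(t0 - s0) / s1:]" using S(2) by simp
  moreover have "t1 / s1 \<noteq> 0" using S T by simp
  ultimately show ?thesis by blast
qed

section \<open>Fibre products of coprime degrees\<close>

lemma poly_prod_mset: "poly (\<Prod>x\<in>#M. f x) y = (\<Prod>x\<in>#M. poly (f x) y)"
  for f :: "_ \<Rightarrow> 'a::comm_semiring_1 poly"
  by (induction M) simp_all

lemma degree_prod_mset_monic_linear:
  "degree (\<Prod>x\<in>#M. [:- f x, 1 :: 'a::idom:]) = size M \<and> lead_coeff (\<Prod>x\<in>#M. [:- f x, 1:]) = 1"
proof (induction M)
  case (add x M)
  then have "(\<Prod>x\<in>#M. [:- f x, 1:]) \<noteq> 0" by (metis leading_coeff_0_iff zero_neq_one)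
  moreover have "lead_coeff ([:- f x, 1:] * (\<Prod>x\<in>#M. [:- f x, 1:])) = 1"
    using add conjunct2[OF add] by (simp only: lead_coeff_mult) simp
  ultimately show ?case using add by (simp add: degree_mult_eq del: mult_pCons_left)
qed simp

lemma fibre_multiset:
  fixes P :: "'a::alg_closed_field poly"
  assumes "degree P > 0"
  shows "\<exists>M. size M = degree P \<and> (\<forall>t. poly P t - x = lead_coeff P * (\<Prod>s\<in>#M. t - s))"
proof -
  have d: "degree (P - [:x:]) = degree P"
    using degree_diff_monom[of 0 P x] assms by (simp add: monom_0)
  then have l: "lead_coeff (P - [:x:]) = lead_coeff P" using assms by (simp add: coeff_pCons split: nat.split)
  have "P - [:x:] \<noteq> 0" using d assms by auto
  from alg_closed_imp_factorization[OF this] obtain M where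
    "size M = degree (P - [:x:])" "P - [:x:] = smult (lead_coeff (P - [:x:])) (\<Prod>x\<in>#M. [:-x, 1:])"
    by (elim exE conjE)
  then have M: "size M = degree P" "P - [:x:] = smult (lead_coeff P) (\<Prod>x\<in>#M. [:-x, 1:])"
    by (simp only: d, simp only: l)
  have "poly P t - x = lead_coeff P * (\<Prod>s\<in>#M. t - s)" for t
    using arg_cong[OF M(2), of "\<lambda>p. poly p t"] by (simp add: poly_prod_mset)
  then show ?thesis using M(1) by blast
qed

lemma sum_distinct_degrees_eq_0:
  fixes f :: "'b \<Rightarrow> 'a::comm_ring_1 poly"
  assumes "finite J" "(\<Sum>j\<in>J. f j) = 0"
    and inj: "\<And>i j. i \<in> J \<Longrightarrow> j \<in> J \<Longrightarrow> f i \<noteq> 0 \<Longrightarrow> f j \<noteq> 0 \<Longrightarrow> degree (f i) = degree (f j) \<Longrightarrow> i = j"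
    and "i \<in> J"
  shows "f i = 0"
proof (rule ccontr)
  assume "f i \<noteq> 0"
  define J' where "J' = {j \<in> J. f j \<noteq> 0}"
  have J': "finite J'" "J' \<noteq> {}" using assms \<open>f i \<noteq> 0\<close> by (auto simp: J'_def)
  define m where "m = Max ((\<lambda>j. degree (f j)) ` J')"
  have "m \<in> (\<lambda>j. degree (f j)) ` J'" unfolding m_def using J' by (intro Max_in) auto
  then obtain k where k: "k \<in> J'" "degree (f k) = m" by auto
  have *: "coeff (f j) m = 0" if "j \<in> J - {k}" for j
  proof (cases "f j = 0")
    case False
    then have "j \<in> J'" using that by (simp add: J'_def)
    then have "degree (f j) \<le> m" unfolding m_def using J' by simp
    moreover have "degree (f j) \<noteq> m" using inj[of j k] k that False by (auto simp: J'_def)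
    ultimately show ?thesis by (simp add: coeff_eq_0)
  qed simp
  have "0 = coeff (\<Sum>j\<in>J. f j) m" using assms(2) by simp
  also have "\<dots> = coeff (f k) m"
    using k(1) assms(1) * by (simp add: coeff_sum J'_def sum.remove[of J k])
  finally show False using k by (auto simp: J'_def)
qed

lemma lagrange_interpolation:
  fixes e :: "'a::field poly"
  assumes "finite Y" "degree e < card Y"
  shows "e = (\<Sum>k\<in>Y. smult (poly e k) (\<Prod>i\<in>Y - {k}. smult (1 / (k - i)) [:- i, 1:]))"
proof (rule poly_eqI_degree[where A = Y])
  fix y assume y: "y \<in> Y"
  have "poly (\<Prod>i\<in>Y - {k}. smult (1 / (k - i)) [:- i, 1:]) y = (if k = y then 1 else 0)" if "k \<in> Y" for k
  proof (cases "k = y")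
    case True
    have "poly (smult (1 / (k - i)) [:- i, 1:]) y = 1" if "i \<in> Y - {k}" for i
      using that True by (auto simp: right_inverse_eq simp flip: diff_divide_distrib)
    then show ?thesis using True by (simp only: poly_prod) (simp only: prod.neutral_const cong: prod.cong, simp)
  next
    case False
    then show ?thesis using y assms(1) by (auto simp: poly_prod)
  qed
  then show "poly e y = poly (\<Sum>k\<in>Y. smult (poly e k) (\<Prod>i\<in>Y - {k}. smult (1 / (k - i)) [:- i, 1:])) y"
    using y assms(1) by (simp add: poly_sum if_distrib[of "\<lambda>z. _ * z"] cong: if_cong)
next
  have "degree (\<Sum>k\<in>Y. smult (poly e k) (\<Prod>i\<in>Y - {k}. smult (1 / (k - i)) [:- i, 1:])) \<le> card Y - 1"
  proof (rule degree_sum_le[OF assms(1)])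
    fix k assume k: "k \<in> Y"
    have "degree (\<Prod>i\<in>Y - {k}. smult (1 / (k - i)) [:- i, 1:]) \<le> (\<Sum>i\<in>Y - {k}. degree (smult (1 / (k - i)) [:- i, 1:]))"
      using degree_prod_sum_le[of "Y - {k}" "\<lambda>i. smult (1 / (k - i)) [:- i, 1:]"] assms(1) by (simp add: o_def)
    also have "\<dots> \<le> (\<Sum>i\<in>Y - {k}. 1)" by (intro sum_mono) simp
    also have "\<dots> = card Y - 1" using k assms(1) by simp
    finally show "degree (smult (poly e k) (\<Prod>i\<in>Y - {k}. smult (1 / (k - i)) [:- i, 1:])) \<le> card Y - 1"
      using degree_smult_le le_trans by blast
  qed
  then show "degree (\<Sum>k\<in>Y. smult (poly e k) (\<Prod>i\<in>Y - {k}. smult (1 / (k - i)) [:- i, 1:])) < card Y"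
    using assms(2) by linarith
qed (use assms in auto)

text \<open>
  The key is the norm \<open>N(x, y)\<close>, the product of \<open>y - Q(t)\<close> over the roots \<open>t\<close> of \<open>P(t) = x\<close>. It is
  visibly a polynomial in \<open>y\<close>, and by symmetry of the resultant also a polynomial in \<open>x\<close>. The
  difference \<open>E\<close> between \<open>N(x, y)\<close> and the normalised \<open>B(y) - A(x)\<close> has degree less than \<open>a\<close> in \<open>y\<close> and
  vanishes on the curve \<open>(P(t), Q(t))\<close>. On this curve the monomials \<open>x\<^sup>i y\<^sup>j\<close> with \<open>j < a\<close> have pairwise
  distinct degrees, since \<open>a\<close> and \<open>D\<close> are coprime; hence \<open>E = 0\<close>. So \<open>A(x) = B(y)\<close> makes a factor
  \<open>y - Q(t)\<close> vanish.
\<close>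

lemma fibre_product_parametrised:
  fixes P Q :: "'a::{alg_closed_field,field_char_0} poly"
  assumes AB: "pcompose A P = pcompose B Q"
    and deg: "degree P = a" "degree B = a" "degree A = D" "degree Q = D" "a > 0" "D > 0"
    and cop: "coprime a D"
    and x0y0: "poly A x0 = poly B y0"
  shows "\<exists>t. poly P t = x0 \<and> poly Q t = y0"
proof -
  define p0 q0 b0 where "p0 = lead_coeff P" and "q0 = lead_coeff Q" and "b0 = lead_coeff B"
  have nz: "p0 \<noteq> 0" "q0 \<noteq> 0" "b0 \<noteq> 0" unfolding p0_def q0_def b0_def using deg by (metis leading_coeff_0_iff degree_0 less_irrefl)+
  have "\<exists>RP. \<forall>x. size (RP x) = a \<and> (\<forall>t. poly P t - x = p0 * (\<Prod>s\<in>#RP x. t - s))"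
    unfolding p0_def using fibre_multiset[of P] deg by (intro choice) auto
  then obtain RP where RP: "size (RP x) = a" "poly P t - x = p0 * (\<Prod>s\<in>#RP x. t - s)" for x t
    by blast
  have "\<exists>RQ. \<forall>y. size (RQ y) = D \<and> (\<forall>t. poly Q t - y = q0 * (\<Prod>s\<in>#RQ y. t - s))"
    unfolding q0_def using fibre_multiset[of Q] deg by (intro choice) auto
  then obtain RQ where RQ: "size (RQ y) = D" "poly Q t - y = q0 * (\<Prod>s\<in>#RQ y. t - s)" for y t
    by blast
  have mem: "t \<in># RP x \<longleftrightarrow> poly P t = x" for t x
  proof -
    have "poly P t = x \<longleftrightarrow> p0 * (\<Prod>s\<in>#RP x. t - s) = 0" by (simp only: RP(2)[of t x, symmetric] right_minus_eq)
    also have "\<dots> \<longleftrightarrow> 0 \<in># {#t - s. s \<in># RP x#}" using nz by (simp only: mult_eq_0_iff prod_mset_zero_iff) simp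
    also have "\<dots> \<longleftrightarrow> t \<in># RP x" by force
    finally show ?thesis by blast
  qed
  define N where "N = (\<lambda>x y. \<Prod>t\<in>#RP x. y - poly Q t)"
  define \<kappa> where "\<kappa> = (- q0) ^ a / ((-1) ^ (a * D) * p0 ^ D)"
  \<comment> \<open>Both sides are, up to constants, the double product of the differences \<open>t - s\<close>.\<close>
  have N_sym: "N x y = \<kappa> * (\<Prod>s\<in>#RQ y. poly P s - x)" for x y
  proof -
    have neg: "(\<Prod>t\<in>#M. - (f t)) = (-1) ^ size M * (\<Prod>t\<in>#M. f t)" for M and f :: "'a \<Rightarrow> 'a"
      by (induction M) simp_all
    have con: "(\<Prod>t\<in>#M. c * f t) = c ^ size M * (\<Prod>t\<in>#M. f t)" for M c and f :: "'a \<Rightarrow> 'a"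
      by (induction M) (simp_all add: mult_ac)
    have "N x y = (\<Prod>t\<in>#RP x. (- q0) * (\<Prod>s\<in>#RQ y. t - s))"
      unfolding N_def by (intro arg_cong[where f = prod_mset] image_mset_cong) (use RQ(2)[of _ y] in \<open>simp add: algebra_simps\<close>)
    also have "\<dots> = (- q0) ^ a * (\<Prod>t\<in>#RP x. \<Prod>s\<in>#RQ y. t - s)" by (simp only: con RP)
    finally have 1: "N x y = (- q0) ^ a * (\<Prod>t\<in>#RP x. \<Prod>s\<in>#RQ y. t - s)" .
    have "(\<Prod>s\<in>#RQ y. poly P s - x) = p0 ^ D * (\<Prod>s\<in>#RQ y. \<Prod>t\<in>#RP x. s - t)"
      by (simp only: RP con RQ)
    also have "(\<Prod>s\<in>#RQ y. \<Prod>t\<in>#RP x. s - t) = (\<Prod>s\<in>#RQ y. (-1) ^ a * (\<Prod>t\<in>#RP x. t - s))"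
      using neg[where f = "\<lambda>t. t - s" for s] by (simp add: RP)
    also have "\<dots> = (-1) ^ (a * D) * (\<Prod>s\<in>#RQ y. \<Prod>t\<in>#RP x. t - s)"
      by (simp only: con RQ power_mult)
    also have "(\<Prod>s\<in>#RQ y. \<Prod>t\<in>#RP x. t - s) = (\<Prod>t\<in>#RP x. \<Prod>s\<in>#RQ y. t - s)"
      by (rule prod_mset.swap)
    finally have 2: "(\<Prod>s\<in>#RQ y. poly P s - x) = p0 ^ D * ((-1) ^ (a * D) * (\<Prod>t\<in>#RP x. \<Prod>s\<in>#RQ y. t - s))" .
    show ?thesis using 1 2 nz by (simp add: \<kappa>_def)
  qed
  define Nx where "Nx = (\<lambda>x. \<Prod>t\<in>#RP x. [:- poly Q t, 1:])"
  define Ny where "Ny = (\<lambda>y. smult \<kappa> (\<Prod>s\<in>#RQ y. [:poly P s, -1:]))"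
  have Nx: "poly (Nx x) y = N x y" for x y by (simp add: Nx_def N_def poly_prod_mset)
  have Ny: "poly (Ny y) x = N x y" for x y by (simp add: Ny_def N_sym poly_prod_mset)
  have Nx_deg: "degree (Nx x) = a" "lead_coeff (Nx x) = 1" for x
    unfolding Nx_def using degree_prod_mset_monic_linear[of "poly Q" "RP x"] RP(1)[of x] by metis+
  define Ex where "Ex = (\<lambda>x. Nx x - smult (1 / b0) (B - [:poly A x:]))"
  define Ey where "Ey = (\<lambda>y. Ny y - smult (1 / b0) ([:poly B y:] - A))"
  have ExEy: "poly (Ex x) y = poly (Ey y) x" for x y
    by (simp add: Ex_def Ey_def Nx Ny)
  have B: "degree (B - [:c:]) = a" "coeff (B - [:c:]) a = b0" for c
    using degree_diff_monom[of 0 B c] deg by (auto simp: monom_0 b0_def coeff_pCons split: nat.split)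
  have Ex_deg: "degree (Ex x) < a" for x
  proof (cases "Nx x = smult (1 / b0) (B - [:poly A x:])")
    case True
    then show ?thesis using deg by (simp add: Ex_def)
  next
    case False
    show ?thesis unfolding Ex_def
      by (rule degree_diff_less_of_coeff_eq) (use Nx_deg[of x] False nz B in \<open>auto simp del: coeff_diff\<close>)
  qed
  obtain Y :: "'a set" where Y: "finite Y" "card Y = a"
    using infinite_arbitrarily_large[OF infinite_UNIV_char_0] by blast
  define L :: "'a \<Rightarrow> 'a poly" where "L = (\<lambda>k. \<Prod>i\<in>Y - {k}. smult (1 / (k - i)) [:- i, 1:])"
  define c where "c = (\<lambda>j. \<Sum>k\<in>Y. smult (coeff (L k) j) (Ey k))"
  \<comment> \<open>Interpolation at the points of \<open>Y\<close> shows that the coefficients of \<open>Ex x\<close> are polynomial in \<open>x\<close>.\<close>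
  have coeff_Ex: "coeff (Ex x) j = poly (c j) x" for x j
  proof -
    have "Ex x = (\<Sum>k\<in>Y. smult (poly (Ex x) k) (L k))"
      unfolding L_def using lagrange_interpolation[of Y "Ex x"] Y Ex_deg by simp
    then have "coeff (Ex x) j = coeff (\<Sum>k\<in>Y. smult (poly (Ex x) k) (L k)) j" by (rule arg_cong)
    then show ?thesis by (simp add: coeff_sum c_def poly_sum ExEy mult.commute)
  qed
  have Ex_param: "poly (Ex (poly P t)) (poly Q t) = 0" for t
  proof -
    have "N (poly P t) (poly Q t) = 0"
      unfolding N_def prod_mset_zero_iff using mem[of t "poly P t"] by force
    moreover have "poly B (poly Q t) = poly A (poly P t)"
      using arg_cong[OF AB, of "\<lambda>p. poly p t"] by (simp add: poly_pcompose)
    ultimately show ?thesis by (simp add: Ex_def Nx)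
  qed
  have "Q \<noteq> 0" using deg by auto
  have "(\<Sum>j<a. pcompose (c j) P * Q ^ j) = 0"
  proof (rule poly_eq_poly_eq_iff[THEN iffD1], rule ext)
    fix t
    have "poly (\<Sum>j<a. pcompose (c j) P * Q ^ j) t = (\<Sum>j<a. coeff (Ex (poly P t)) j * poly Q t ^ j)"
      by (simp add: poly_sum poly_pcompose coeff_Ex)
    also have "\<dots> = poly (Ex (poly P t)) (poly Q t)"
      unfolding poly_altdef[of "Ex _"]
      by (rule sum.mono_neutral_right) (use Ex_deg[of "poly P t"] in \<open>auto simp: coeff_eq_0\<close>)
    finally show "poly (\<Sum>j<a. pcompose (c j) P * Q ^ j) t = poly 0 t" using Ex_param by simp
  qed
  then have "pcompose (c j) P * Q ^ j = 0" if "j < a" for j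
  proof (rule sum_distinct_degrees_eq_0[rotated])
    fix i j assume ij: "i \<in> {..<a}" "j \<in> {..<a}" "pcompose (c i) P * Q ^ i \<noteq> 0" "pcompose (c j) P * Q ^ j \<noteq> 0"
      and eq: "degree (pcompose (c i) P * Q ^ i) = degree (pcompose (c j) P * Q ^ j)"
    have "degree (pcompose (c k) P * Q ^ k) = degree (c k) * a + k * D" if "pcompose (c k) P * Q ^ k \<noteq> 0" for k
      using that deg \<open>Q \<noteq> 0\<close> by (simp add: degree_mult_eq degree_power_eq degree_pcompose)
    with ij eq have eq: "degree (c i) * a + i * D = degree (c j) * a + j * D" by simp
    have aux: False if "i < j" "j < a" "degree (c i) * a + i * D = degree (c j) * a + j * D" for i j
    proof -
      have "int a dvd (int j - int i) * int D"
      proof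
        have "int (degree (c i) * a + i * D) = int (degree (c j) * a + j * D)" using that(3) by (rule arg_cong)
        then show "(int j - int i) * int D = int a * (int (degree (c i)) - int (degree (c j)))"
          by (simp add: algebra_simps)
      qed
      then have "int a dvd int j - int i"
        using cop by (metis coprime_dvd_mult_left_iff coprime_int_iff)
      then show False using that zdvd_imp_le[of "int a" "int j - int i"] by simp
    qed
    show "i = j" using aux[of i j] aux[of j i] eq ij by (metis lessThan_iff linorder_neqE_nat)
  qed (use that in auto)
  then have "c j = 0" if "j < a" for j
    using that deg \<open>Q \<noteq> 0\<close> pcompose_eq_0[of "c j" P] by simp
  then have "coeff (Ex x0) j = 0" for j
    using Ex_deg[of x0] coeff_Ex[of x0 j] by (cases "j < a") (simp, simp add: coeff_eq_0)
  then have "Ex x0 = 0" by (simp add: poly_eq_iff)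
  then have "poly (Ex x0) y0 = 0" by simp
  then have "N x0 y0 = 0" using x0y0 by (simp add: Ex_def Nx)
  then have "0 \<in># {#y0 - poly Q t. t \<in># RP x0#}" unfolding N_def by (simp only: prod_mset_zero_iff)
  then obtain t where "t \<in># RP x0" "y0 = poly Q t" by force
  then show ?thesis using mem by blast
qed

section \<open>Ramification indices and the Chebyshev portrait\<close>

text \<open>
  The ramification index of \<open>f\<close> at \<open>x\<close>, that is, the multiplicity of \<open>x\<close> in its fibre.
\<close>

definition ram :: "'a::field poly \<Rightarrow> 'a \<Rightarrow> nat"
  where "ram f x = order x (f - [:poly f x:])"

lemma order_power: "p \<noteq> 0 \<Longrightarrow> order x (p ^ n) = n * order x p"
  for p :: "'a::idom poly"
  by (induction n) (simp_all add: order_mult)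

lemma diff_const_nonzero:
  fixes f :: "'a::field poly"
  assumes "degree f > 0" shows "f - [:c:] \<noteq> 0"
proof
  assume "f - [:c:] = 0"
  then have "f = [:c:]" by (simp only: right_minus_eq)
  then show False using assms by simp
qed

lemma ram_pos: "degree f > 0 \<Longrightarrow> ram f x > 0"
  unfolding ram_def using diff_const_nonzero[of f] by (subst order_gt_0_iff) auto

lemma ram_le_degree: "degree f > 0 \<Longrightarrow> ram f x \<le> degree f"
  unfolding ram_def using diff_const_nonzero[of f "poly f x"] order_degree[of "f - [:poly f x:]" x]
    degree_diff_monom[of 0 f "poly f x"] by (simp add: monom_0)

lemma ram_pcompose:
  fixes f g :: "'a::field poly"
  assumes "degree f > 0" "degree g > 0"
  shows "ram (pcompose f g) x = ram f (poly g x) * ram g x"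
proof -
  define y where "y = poly g x"
  have "f - [:poly f y:] \<noteq> 0" using diff_const_nonzero assms(1) .
  from order_decomp[OF this, of y] obtain G where
    G: "f - [:poly f y:] = [:- y, 1:] ^ ram f y * G" "\<not> [:- y, 1:] dvd G"
    unfolding ram_def by blast
  have Gy: "poly G y \<noteq> 0" using G(2) by (simp add: poly_eq_0_iff_dvd)
  have "pcompose f g - [:poly (pcompose f g) x:] = pcompose (f - [:poly f y:]) g"
    by (simp add: pcompose_diff poly_pcompose y_def)
  also have "\<dots> = (g - [:y:]) ^ ram f y * pcompose G g"
  proof -
    have "pcompose [:- y, 1:] g = g - [:y:]"
      by (rule poly_eqI) (simp add: pcompose_pCons coeff_pCons split: nat.split)
    then show ?thesis unfolding G(1) by (simp only: pcompose_mult pcompose_power)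
  qed
  finally have eq: "pcompose f g - [:poly (pcompose f g) x:] = (g - [:y:]) ^ ram f y * pcompose G g" .
  have ne: "g - [:y:] \<noteq> 0" "pcompose G g \<noteq> 0"
    using diff_const_nonzero[OF assms(2)] Gy assms(2) pcompose_eq_0[of G g] by auto
  have "order x (pcompose G g) = 0" using Gy by (intro order_0I) (simp add: poly_pcompose y_def)
  then have "ram (pcompose f g) x = ram f y * order x (g - [:y:])"
    unfolding ram_def[of "pcompose f g"] eq using ne by (subst order_mult) (simp_all add: order_power)
  then show ?thesis by (simp add: ram_def y_def)
qed

lemma ram_linear: "degree l = 1 \<Longrightarrow> ram l x = 1"
  using ram_pos[of l x] ram_le_degree[of l x] by simp

lemma finite_fibre: "degree f > 0 \<Longrightarrow> finite W \<Longrightarrow> finite {x. poly f x \<in> W}"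
  for f :: "'a::field poly"
proof -
  assume *: "degree f > 0" "finite W"
  have "finite {x. poly (f - [:w:]) x = 0}" for w
    by (rule poly_roots_finite) (rule diff_const_nonzero[OF *(1)])
  then have "finite (\<Union>w\<in>W. {x. poly (f - [:w:]) x = 0})" using *(2) by blast
  moreover have "{x. poly f x \<in> W} = (\<Union>w\<in>W. {x. poly (f - [:w:]) x = 0})" by auto
  ultimately show ?thesis by simp
qed

lemma size_proots_alg_closed:
  fixes p :: "'a::alg_closed_field poly"
  assumes "p \<noteq> 0"
  shows "p = smult (lead_coeff p) (\<Prod>x\<in>#proots p. [:-x, 1:])" "size (proots p) = degree p"
proof -
  obtain M where M: "size M = degree p" "p = smult (lead_coeff p) (\<Prod>x\<in>#M. [:-x, 1:])"
    using alg_closed_imp_factorization[OF assms] by (elim exE conjE)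
  have "proots p = proots (\<Prod>x\<in>#M. [:-x, 1:])"
    by (subst M(2), rule proots_smult) (use assms in auto)
  also have "\<dots> = M"
  proof -
    have "proots (\<Prod>x\<in>#M. [:-x, 1:]) = M" for M :: "'a multiset"
    proof (induction M)
      case (add x M)
      have "(\<Prod>x\<in>#M. [:-x, 1:]) \<noteq> 0" by (auto simp: prod_mset_zero_iff)
      then show ?case using add by (simp add: proots_mult del: mult_pCons_left)
    qed simp
    then show ?thesis .
  qed
  finally have eq: "proots p = M" .
  show "p = smult (lead_coeff p) (\<Prod>x\<in>#proots p. [:-x, 1:])" "size (proots p) = degree p"
    unfolding eq using M by simp_all
qed

lemma sum_order_eq_degree:
  fixes p :: "'a::alg_closed_field poly"
  assumes "p \<noteq> 0"
  shows "(\<Sum>x | poly p x = 0. order x p) = degree p"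
proof -
  have "degree p = size (proots p)" using size_proots_alg_closed(2)[OF assms] by simp
  also have "\<dots> = (\<Sum>x\<in>{x. poly p x = 0}. order x p)"
    unfolding size_multiset_overloaded_eq set_count_proots[OF assms]
    by (rule sum.cong) (simp_all only: count_proots[OF assms])
  finally show ?thesis by simp
qed

lemma sum_ram_fibre:
  fixes f :: "'a::alg_closed_field poly"
  assumes "degree f > 0"
  shows "(\<Sum>x | poly f x = c. ram f x) = degree f"
proof -
  let ?p = "f - [:c:]"
  have p: "?p \<noteq> 0" using diff_const_nonzero assms .
  have "degree f = degree ?p" using degree_diff_monom[of 0 f c] assms by (simp add: monom_0)
  also have "\<dots> = (\<Sum>x | poly ?p x = 0. order x ?p)" using sum_order_eq_degree[OF p] by simp
  also have "\<dots> = (\<Sum>x | poly f x = c. ram f x)"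
    by (rule sum.cong) (auto simp: ram_def)
  finally show ?thesis by simp
qed

lemma sum_ram_preimage:
  fixes f :: "'a::alg_closed_field poly"
  assumes "degree f > 0" "finite W"
  shows "(\<Sum>x | poly f x \<in> W. ram f x) = degree f * card W"
proof -
  have "(\<Sum>x | poly f x \<in> W. ram f x) = (\<Sum>w\<in>W. \<Sum>x | x \<in> {x. poly f x \<in> W} \<and> poly f x = w. ram f x)"
    by (rule sum.group[symmetric]) (use finite_fibre[OF assms] assms in auto)
  also have "\<dots> = (\<Sum>w\<in>W. degree f)"
  proof (rule sum.cong)
    fix w assume "w \<in> W"
    then have "{x. x \<in> {x. poly f x \<in> W} \<and> poly f x = w} = {x. poly f x = w}" by auto
    then show "(\<Sum>x | x \<in> {x. poly f x \<in> W} \<and> poly f x = w. ram f x) = degree f"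
      using sum_ram_fibre[OF assms(1)] by simp
  qed simp
  finally show ?thesis by simp
qed

lemma order_pderiv_ram:
  fixes f :: "'a::field_char_0 poly"
  assumes "degree f > 0"
  shows "order x (pderiv f) = ram f x - 1"
proof -
  have "order x (f - [:poly f x:]) = Suc (order x (pderiv (f - [:poly f x:])))"
    by (rule order_pderiv) (use diff_const_nonzero[OF assms] in auto)
  then show ?thesis by (simp add: ram_def pderiv_diff)
qed

lemma pderiv_nonzero: "degree f > 0 \<Longrightarrow> pderiv f \<noteq> 0"
  for f :: "'a::field_char_0 poly"
  using pderiv_eq_0_iff[of f] by simp

text \<open>
  The Riemann-Hurwitz inequality for a polynomial: the ramification indices, lowered by one, are
  the orders of the zeros of the derivative.
\<close>

lemma sum_ram_le:
  fixes f :: "'a::field_char_0 poly"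
  assumes "degree f > 0" "finite X"
  shows "(\<Sum>x\<in>X. ram f x - 1) \<le> degree f - 1"
proof -
  have p: "pderiv f \<noteq> 0" using pderiv_nonzero assms(1) .
  have "(\<Sum>x\<in>X. ram f x - 1) = (\<Sum>x\<in>X. order x (pderiv f))"
    using order_pderiv_ram[OF assms(1)] by simp
  also have "\<dots> = (\<Sum>x\<in>X \<inter> {x. poly (pderiv f) x = 0}. order x (pderiv f))"
    by (rule sum.mono_neutral_right) (use assms p in \<open>auto simp: order_eq_0_iff\<close>)
  also have "\<dots> \<le> (\<Sum>x | poly (pderiv f) x = 0. order x (pderiv f))"
    by (rule sum_mono2) (use p poly_roots_finite in auto)
  also have "\<dots> \<le> degree (pderiv f)" by (rule sum_order_le_degree[OF p])
  finally show ?thesis by (simp add: degree_pderiv)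
qed

text \<open>
  This is the ramification portrait of \<open>\<plusminus>T\<^sub>\<delta>\<close> with \<open>W = {2, -2}\<close>: over the two points of \<open>W\<close>, the map is
  unramified at \<open>W\<close> itself and simply ramified everywhere else.
\<close>

definition cheb_like :: "'a::field poly \<Rightarrow> bool"
  where "cheb_like f \<longleftrightarrow> (\<exists>W. card W = 2 \<and> (\<forall>x\<in>W. poly f x \<in> W) \<and>
     (\<forall>x. poly f x \<in> W \<longrightarrow> ram f x = (if x \<in> W then 1 else 2)))"

text \<open>
  The portrait of \<open>x\<^sup>\<delta>\<close>: a totally ramified fixed point.
\<close>

definition power_like :: "'a::field poly \<Rightarrow> bool"
  where "power_like f \<longleftrightarrow> (\<exists>v. poly f v = v \<and> ram f v = degree f)"

lemma sum_eq_pointwise: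
  fixes f g :: "'b \<Rightarrow> nat"
  assumes "finite A" "\<And>x. x \<in> A \<Longrightarrow> g x \<le> f x" "sum f A \<le> sum g A" "x \<in> A"
  shows "f x = g x"
proof (rule ccontr)
  assume "f x \<noteq> g x"
  then have "g x < f x" using assms(2)[OF assms(4)] by simp
  then have "sum g A < sum f A" using assms(1,2,4) by (intro sum_strict_mono_ex1) auto
  then show False using assms by simp
qed

text \<open>
  Let \<open>w\<close> be the number of points in \<open>W\<close> and let \<open>z\<close> be the number of further points in its preimage. The
  fibres over \<open>W\<close> have total multiplicity \<open>d w \<ge> w + 2 z\<close>, while Riemann-Hurwitz gives
  \<open>d w - w - z \<le> d - 1\<close>. Together these force \<open>w \<le> 2\<close>. If \<open>w = 2\<close>, both inequalities are equalities, so
  all indices have their minimal values.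
\<close>

lemma cheb_like_criterion:
  fixes f :: "'a::{alg_closed_field,field_char_0} poly"
  assumes deg: "degree f \<ge> 2" and W: "finite W" "card W \<ge> 2"
    and inv: "\<And>x. x \<in> W \<Longrightarrow> poly f x \<in> W"
    and ramified: "\<And>x. poly f x \<in> W \<Longrightarrow> x \<notin> W \<Longrightarrow> ram f x \<ge> 2"
  shows "cheb_like f"
proof -
  define d w Z z where "d = degree f" and "w = card W" and "Z = {x. poly f x \<in> W}" and "z = card (Z - W)"
  have d: "d \<ge> 2" "degree f > 0" using deg by (auto simp: d_def)
  have Z: "finite Z" "W \<subseteq> Z" unfolding Z_def using finite_fibre[OF d(2) W(1)] inv by auto
  have rp: "ram f x \<ge> 1" for x using ram_pos[OF d(2), of x] by simp
  define R1 R2 where "R1 = (\<Sum>x\<in>W. ram f x)" and "R2 = (\<Sum>x\<in>Z - W. ram f x)"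
  have "(\<Sum>x\<in>Z. ram f x) = d * w" unfolding Z_def d_def w_def using sum_ram_preimage[OF d(2) W(1)] .
  then have R: "R1 + R2 = d * w"
    unfolding R1_def R2_def using sum.subset_diff[OF Z(2,1), of "ram f"] by simp
  have "(\<Sum>x\<in>Z. ram f x - 1) + card Z = (\<Sum>x\<in>Z. ram f x)"
  proof -
    have "(\<Sum>x\<in>Z. ram f x) = (\<Sum>x\<in>Z. (ram f x - 1) + 1)" using rp by (intro sum.cong) (simp_all only: le_add_diff_inverse2)
    also have "\<dots> = (\<Sum>x\<in>Z. ram f x - 1) + card Z" by (simp only: sum.distrib) simp
    finally show ?thesis ..
  qed
  moreover have "(\<Sum>x\<in>Z. ram f x - 1) \<le> d - 1" unfolding d_def using sum_ram_le[OF d(2) Z(1)] .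
  moreover have "card Z = w + z"
    unfolding w_def z_def using Z W by (metis card_Diff_subset card_mono le_add_diff_inverse)
  ultimately have RH: "d * w \<le> d - 1 + (w + z)" using \<open>(\<Sum>x\<in>Z. ram f x) = d * w\<close> by linarith
  have "(\<Sum>x\<in>W. 1) \<le> R1" unfolding R1_def using rp by (intro sum_mono) auto
  then have R1: "w \<le> R1" by (simp add: w_def)
  have "(\<Sum>x\<in>Z - W. 2) \<le> R2" unfolding R2_def
    using ramified by (intro sum_mono) (auto simp: Z_def)
  then have R2: "2 * z \<le> R2" by (simp add: z_def)
  obtain e where e: "d = Suc e" "e > 0" using d by (cases d) auto
  have "e * w \<le> e + z" "2 * z \<le> e * w" using RH R R1 R2 e by auto
  then have "e * w \<le> e * 2" by linarith
  then have w2: "w = 2" using e W by (auto simp: w_def)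
  then have tight: "R1 \<le> w" "R2 \<le> 2 * z" using RH R R1 R2 e by auto
  have "ram f x = 1" if "x \<in> W" for x
    by (rule sum_eq_pointwise[of W "\<lambda>_. 1" "ram f"]) (use W rp tight that in \<open>auto simp: R1_def w_def\<close>)
  moreover have "ram f x = 2" if "x \<in> Z - W" for x
    by (rule sum_eq_pointwise[of "Z - W" "\<lambda>_. 2" "ram f"]) (use Z ramified tight that in \<open>auto simp: R2_def z_def Z_def\<close>)
  ultimately show ?thesis unfolding cheb_like_def
    using w2 inv by (intro exI[of _ W]) (auto simp: w_def Z_def)
qed

lemma cheb_like_unramified_elsewhere:
  fixes f :: "'a::{alg_closed_field,field_char_0} poly"
  assumes deg: "degree f > 0" and W: "card W = 2" "\<forall>x\<in>W. poly f x \<in> W"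
    "\<forall>x. poly f x \<in> W \<longrightarrow> ram f x = (if x \<in> W then 1 else 2)"
    and x: "poly f x \<notin> W"
  shows "ram f x = 1"
proof -
  define Z where "Z = {x. poly f x \<in> W}"
  have finW: "finite W" using W(1) by (intro card_ge_0_finite) simp
  have Z: "finite Z" "W \<subseteq> Z" unfolding Z_def using finite_fibre[OF deg finW] W by auto
  have "degree f * 2 = (\<Sum>x\<in>Z. ram f x)" unfolding Z_def using sum_ram_preimage[OF deg finW] W by simp
  also have "\<dots> = (\<Sum>x\<in>Z - W. ram f x) + (\<Sum>x\<in>W. ram f x)" by (rule sum.subset_diff[OF Z(2,1)])
  also have "(\<Sum>x\<in>W. ram f x) = (\<Sum>x\<in>W. 1)" using W by (intro sum.cong) auto
  also have "(\<Sum>x\<in>Z - W. ram f x) = (\<Sum>x\<in>Z - W. 2)" using W by (intro sum.cong) (auto simp: Z_def)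
  finally have z: "card (Z - W) = degree f - 1" using W by simp
  have "(\<Sum>y\<in>insert x (Z - W). ram f y - 1) \<le> degree f - 1" using sum_ram_le[OF deg] Z by simp
  moreover have "(\<Sum>y\<in>insert x (Z - W). ram f y - 1) = (ram f x - 1) + (\<Sum>y\<in>Z - W. ram f y - 1)"
    using Z x by (subst sum.insert) (auto simp: Z_def)
  moreover have "(\<Sum>y\<in>Z - W. ram f y - 1) = (\<Sum>y\<in>Z - W. 1)" using W by (intro sum.cong) (auto simp: Z_def)
  ultimately have "ram f x - 1 \<le> 0" using z by simp
  then show ?thesis using ram_pos[OF deg, of x] by simp
qed

section \<open>Iterates and exchanged factors\<close>

lemma poly_iter_0 [simp]: "poly_iter f 0 = [:0, 1:]"
  by (simp add: poly_iter_def)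

lemma poly_iter_Suc: "poly_iter f (Suc n) = pcompose f (poly_iter f n)"
  by (simp add: poly_iter_def)

lemma pcompose_idL [simp]: "pcompose [:0, 1:] p = p"
  for p :: "'a::comm_semiring_1 poly"
  by (simp add: pcompose_pCons)

lemma poly_iter_add: "poly_iter f (m + n) = pcompose (poly_iter f m) (poly_iter f n)"
  for f :: "'a::comm_ring_1 poly"
  by (induction m) (simp_all add: poly_iter_Suc pcompose_assoc)

lemma poly_iter_1 [simp]: "poly_iter f (Suc 0) = f"
  by (simp add: poly_iter_Suc)

lemma poly_iter_Suc_right: "poly_iter f (Suc n) = pcompose (poly_iter f n) f"
  for f :: "'a::comm_ring_1 poly"
  using poly_iter_add[of f n "Suc 0"] by simp

lemma degree_poly_iter: "degree (poly_iter f n) = degree f ^ n"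
  for f :: "'a::idom poly"
  by (induction n) (simp_all add: poly_iter_Suc degree_pcompose)

lemma poly_iter_intertwine:
  fixes f :: "'a::comm_ring_1 poly"
  assumes "pcompose f p = pcompose p h"
  shows "pcompose (poly_iter f n) p = pcompose p (poly_iter h n)"
proof (induction n)
  case (Suc n)
  have "pcompose (poly_iter f (Suc n)) p = pcompose f (pcompose (poly_iter f n) p)"
    by (simp add: poly_iter_Suc pcompose_assoc)
  also have "\<dots> = pcompose (pcompose f p) (poly_iter h n)"
    by (simp add: Suc pcompose_assoc)
  also have "\<dots> = pcompose p (poly_iter h (Suc n))"
    by (simp add: assms poly_iter_Suc pcompose_assoc)
  finally show ?case .
qed simp

lemma ram_id: "ram [:0, 1:] x = 1"
  by (rule ram_linear) simp

text \<open>
  Information about the iterate is spread along the orbit. The set \<open>w i\<close> consists of the points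
  that \<open>f\<^sup>i\<close> sends into \<open>V\<close> with an index not divisible by \<open>m\<close>, so the hypothesis on \<open>V\<close> says that
  \<open>w M = V = w 0\<close>. By multiplicativity of the index, \<open>f\<close> maps \<open>w (i + 1)\<close> into \<open>w i\<close>, and a
  preimage of \<open>w i\<close> outside \<open>w (i + 1)\<close> is ramified. The union of the \<open>w i\<close> is the required set.
\<close>

lemma ram_iterate_witness:
  fixes f :: "'a::field poly" and V :: "'a set"
  assumes deg: "degree f > 0" and V: "finite V" "M > 0" "m \<ge> 2"
    and VM: "V = {y. poly (poly_iter f M) y \<in> V \<and> \<not> m dvd ram (poly_iter f M) y}"
  shows "\<exists>W. finite W \<and> V \<subseteq> W \<and> (\<forall>x\<in>W. poly f x \<in> W) \<and> (\<forall>x. poly f x \<in> W \<longrightarrow> x \<notin> W \<longrightarrow> ram f x \<ge> 2) \<and>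
     (\<forall>x. poly f x \<in> V \<longrightarrow> \<not> m dvd ram f x \<longrightarrow> x \<in> W)"
proof -
  define w where "w = (\<lambda>i. {y. poly (poly_iter f i) y \<in> V \<and> \<not> m dvd ram (poly_iter f i) y})"
  define W where "W = (\<Union>i<M. w i)"
  have w0: "w 0 = V" using V(3) by (auto simp: w_def ram_id)
  have wM: "w M = V" using VM by (simp add: w_def)
  have ram_Suc: "ram (poly_iter f (Suc i)) y = ram (poly_iter f i) (poly f y) * ram f y" for i y
    unfolding poly_iter_Suc_right using deg by (intro ram_pcompose) (simp_all add: degree_poly_iter)
  have poly_Suc: "poly (poly_iter f (Suc i)) y = poly (poly_iter f i) (poly f y)" for i y
    by (simp add: poly_iter_Suc_right poly_pcompose)
  have wW: "w i \<subseteq> W" if "i \<le> M" for i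
  proof (cases "i = M")
    case True
    then show ?thesis using wM w0 V(2) by (auto simp: W_def)
  next
    case False
    then have "i < M" using that by simp
    then show ?thesis by (auto simp: W_def)
  qed
  have down: "poly f y \<in> w i" if "y \<in> w (Suc i)" for i y
    using that unfolding w_def ram_Suc poly_Suc by auto
  have "finite (w i)" for i
  proof (rule finite_subset)
    show "w i \<subseteq> {y. poly (poly_iter f i) y \<in> V}" by (auto simp: w_def)
    show "finite {y. poly (poly_iter f i) y \<in> V}"
      using deg V(1) by (intro finite_fibre) (simp_all add: degree_poly_iter)
  qed
  then have 1: "finite W" by (simp add: W_def)
  have 2: "V \<subseteq> W" using wW[of 0] w0 by simp
  have 3: "poly f x \<in> W" if "x \<in> W" for x
  proof -
    from that obtain i where i: "i < M" "x \<in> w i" by (auto simp: W_def)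
    have "\<exists>j<M. x \<in> w (Suc j)"
    proof (cases i)
      case 0
      then show ?thesis using w0 wM i by (intro exI[of _ "M - 1"]) simp
    next
      case (Suc j)
      then show ?thesis using i by (metis Suc_lessD)
    qed
    then show ?thesis using down by (auto simp: W_def)
  qed
  have 4: "ram f x \<ge> 2" if x: "poly f x \<in> W" "x \<notin> W" for x
  proof -
    from x(1) obtain i where i: "i < M" "poly f x \<in> w i" by (auto simp: W_def)
    then have "x \<notin> w (Suc i)" using wW[of "Suc i"] x(2) by auto
    then have "m dvd ram (poly_iter f i) (poly f x) * ram f x" "\<not> m dvd ram (poly_iter f i) (poly f x)"
      using i unfolding w_def ram_Suc poly_Suc by auto
    then have "ram f x \<noteq> 1" by auto
    then show ?thesis using ram_pos[OF deg, of x] by simp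
  qed
  have 5: "x \<in> W" if "poly f x \<in> V" "\<not> m dvd ram f x" for x
    using wW[of 1] that V(2) by (auto simp: w_def)
  show ?thesis using 1 2 3 4 5 by blast
qed

lemma cheb_like_of_iterate:
  fixes f :: "'a::{alg_closed_field,field_char_0} poly"
  assumes deg: "degree f \<ge> 2" and "M > 0" "cheb_like (poly_iter f M)"
  shows "cheb_like f"
proof -
  obtain V where V: "card V = 2" "\<forall>x\<in>V. poly (poly_iter f M) x \<in> V"
    "\<forall>x. poly (poly_iter f M) x \<in> V \<longrightarrow> ram (poly_iter f M) x = (if x \<in> V then 1 else 2)"
    using assms(3) unfolding cheb_like_def by blast
  have finV: "finite V" using V(1) by (intro card_ge_0_finite) simp
  have VM: "V = {y. poly (poly_iter f M) y \<in> V \<and> \<not> 2 dvd ram (poly_iter f M) y}"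
    using V(2,3) by (auto split: if_splits)
  have "degree f > 0" using deg by simp
  from ram_iterate_witness[OF this finV \<open>M > 0\<close> order_refl VM] obtain W where
    W: "finite W" "V \<subseteq> W" "\<forall>x\<in>W. poly f x \<in> W" "\<forall>x. poly f x \<in> W \<longrightarrow> x \<notin> W \<longrightarrow> ram f x \<ge> 2"
    by blast
  have "card W \<ge> 2" using card_mono[OF W(1,2)] V(1) by simp
  then show ?thesis using W deg by (intro cheb_like_criterion[of f W]) auto
qed

text \<open>
  If \<open>V\<close> is the exceptional pair of \<open>h \<circ> u\<close>, then the points over \<open>V\<close> at which \<open>h\<close> has an odd index satisfy
  the criterion for \<open>u \<circ> h\<close>. There are at least two of them because Riemann-Hurwitz for \<open>h\<close> bounds the
  number of points of even index over \<open>V\<close>.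
\<close>

lemma cheb_like_swap:
  fixes h u :: "'a::{alg_closed_field,field_char_0} poly"
  assumes deg: "degree h > 0" "degree u > 0" "degree h * degree u \<ge> 2"
    and cheb: "cheb_like (pcompose h u)"
  shows "cheb_like (pcompose u h)"
proof -
  define F where "F = pcompose h u"
  obtain V where V: "card V = 2" "\<forall>x\<in>V. poly F x \<in> V"
    "\<forall>x. poly F x \<in> V \<longrightarrow> ram F x = (if x \<in> V then 1 else 2)"
    using cheb unfolding cheb_like_def F_def by blast
  have finV: "finite V" using V(1) by (intro card_ge_0_finite) simp
  have ramF: "ram F x = ram h (poly u x) * ram u x" for x
    unfolding F_def by (rule ram_pcompose[OF deg(1,2)])
  have ram_uh: "ram (pcompose u h) x = ram u (poly h x) * ram h x" for x
    by (rule ram_pcompose[OF deg(2,1)])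
  have polyF: "poly F x = poly h (poly u x)" for x by (simp add: F_def poly_pcompose)
  define Z where "Z = {y. poly h y \<in> V}"
  define W where "W = {y \<in> Z. odd (ram h y)}"
  have Z: "finite Z" unfolding Z_def by (rule finite_fibre[OF deg(1) finV])
  have WZ: "W \<subseteq> Z" by (auto simp: W_def)
  have rp: "ram h x \<ge> 1" for x using ram_pos[OF deg(1), of x] by simp
  have 1: "(\<Sum>x\<in>Z. ram h x) = degree h * 2"
    unfolding Z_def using sum_ram_preimage[OF deg(1) finV] V(1) by simp
  have "(\<Sum>x\<in>Z. ram h x) = (\<Sum>x\<in>Z. (ram h x - 1) + 1)"
    using rp by (intro sum.cong) (simp_all only: le_add_diff_inverse2)
  also have "\<dots> = (\<Sum>x\<in>Z. ram h x - 1) + card Z" by (simp only: sum.distrib) simp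
  finally have 2: "degree h + 1 \<le> card Z" using 1 deg(1) sum_ram_le[OF deg(1) Z] by simp
  have 3: "(\<Sum>x\<in>Z. if x \<in> W then 1 else 2) \<le> (\<Sum>x\<in>Z. ram h x)"
  proof (rule sum_mono)
    fix x assume x: "x \<in> Z"
    show "(if x \<in> W then 1 else 2) \<le> ram h x"
    proof (cases "x \<in> W")
      case False
      then have "even (ram h x)" using x by (simp add: W_def)
      then have "ram h x \<noteq> 1" by auto
      then show ?thesis using rp[of x] False by simp
    next
      case True
      then show ?thesis using rp[of x] by simp
    qed
  qed
  have 4: "(\<Sum>x\<in>Z. if x \<in> W then 1 else 2) + card W = 2 * card Z"
  proof -
    have "(\<Sum>x\<in>Z. if x \<in> W then 1 else 2) = (\<Sum>x\<in>Z - W. if x \<in> W then 1 else 2) + (\<Sum>x\<in>W. if x \<in> W then 1 else (2::nat))"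
      by (rule sum.subset_diff[OF WZ Z])
    also have "\<dots> = 2 * card (Z - W) + card W" by simp
    also have "card (Z - W) = card Z - card W"
      using WZ Z by (meson card_Diff_subset finite_subset)
    finally show ?thesis using card_mono[OF Z WZ] by simp
  qed
  have cardW: "card W \<ge> 2" using 1 2 3 4 by linarith
  have uV: "poly u v \<in> W" if "v \<in> V" for v
  proof -
    have "poly h (poly u v) \<in> V" using V(2) that polyF by simp
    moreover have "ram h (poly u v) * ram u v = 1" using V(3) calculation that ramF polyF by auto
    ultimately show ?thesis by (simp add: W_def Z_def)
  qed
  have inv: "poly (pcompose u h) x \<in> W" if "x \<in> W" for x
    using that uV by (simp add: W_def Z_def poly_pcompose)
  have ramif: "ram (pcompose u h) x \<ge> 2" if x: "poly (pcompose u h) x \<in> W" "x \<notin> W" for x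
  proof -
    have fx: "poly h (poly u (poly h x)) \<in> V" "odd (ram h (poly u (poly h x)))"
      using x(1) by (auto simp: W_def Z_def poly_pcompose)
    have "even (ram u (poly h x) * ram h x)"
    proof (cases "poly h x \<in> V")
      case True
      then show ?thesis using x(2) by (simp add: W_def Z_def)
    next
      case False
      then have "ram F (poly h x) = 2" using V(3) fx(1) by (simp add: polyF)
      then have "even (ram h (poly u (poly h x)) * ram u (poly h x))" unfolding ramF by simp
      then show ?thesis using fx by simp
    qed
    then have "ram (pcompose u h) x \<noteq> 1" unfolding ram_uh by (metis odd_one)
    moreover have "ram (pcompose u h) x > 0"
      using deg by (intro ram_pos) (simp add: degree_pcompose)
    ultimately show ?thesis by simp
  qed
  show ?thesis
    by (rule cheb_like_criterion[where W = W])
       (use deg Z WZ cardW inv ramif finite_subset in \<open>auto simp: degree_pcompose mult.commute\<close>)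
qed

lemma power_like_swap:
  fixes h u :: "'a::field poly"
  assumes deg: "degree h > 0" "degree u > 0"
    and "power_like (pcompose h u)"
  shows "power_like (pcompose u h)"
proof -
  obtain v where v: "poly h (poly u v) = v" "ram h (poly u v) * ram u v = degree h * degree u"
    using assms(3) unfolding power_like_def ram_pcompose[OF deg] degree_pcompose poly_pcompose by blast
  have "ram (pcompose u h) (poly u v) = ram u v * ram h (poly u v)"
    using ram_pcompose[OF deg(2,1)] v(1) by simp
  then have "ram (pcompose u h) (poly u v) = degree (pcompose u h)"
    using v(2) by (simp add: degree_pcompose mult.commute)
  then show ?thesis unfolding power_like_def using v(1) by (intro exI[of _ "poly u v"]) (simp add: poly_pcompose)
qed

section \<open>Power maps and Chebyshev polynomials by ramification\<close>

text \<open>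
  The Chebyshev polynomials of the second kind, in the normalisation that makes
  \<open>n U\<^sub>n\<close> the derivative of \<open>T\<^sub>n\<close>.
\<close>

fun cheb_second :: "nat \<Rightarrow> 'a::field poly"
  where
    "cheb_second 0 = 0"
  | "cheb_second (Suc 0) = 1"
  | "cheb_second (Suc (Suc n)) = [:0, 1:] * cheb_second (Suc n) - cheb_second n"

lemma cheb_addition:
  "2 * (cheb_rec (Suc n) :: 'a::field_char_0 poly) = [:0, 1:] * cheb_rec n + ([:0, 1:] ^ 2 - 4) * cheb_second n \<and>
   2 * cheb_second (Suc n) = cheb_rec n + [:0, 1:] * (cheb_second n :: 'a poly)"
proof -
  define X :: "'a poly" where "X = [:0, 1:]"
  have "2 * cheb_rec (Suc n) = X * cheb_rec n + (X ^ 2 - 4) * cheb_second n \<and>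
    2 * cheb_second (Suc n) = cheb_rec n + X * cheb_second n"
  proof (induction n)
    case 0
    show ?case by (simp add: X_def numeral_poly)
  next
    case (Suc n)
    define T U T' U' where "T = (cheb_rec n :: 'a poly)" and "U = (cheb_second n :: 'a poly)"
      and "T' = (cheb_rec (Suc n) :: 'a poly)" and "U' = (cheb_second (Suc n) :: 'a poly)"
    have IH: "2 * T' = X * T + (X ^ 2 - 4) * U" "2 * U' = T + X * U"
      using Suc by (simp_all only: T_def U_def T'_def U'_def)
    have rec: "cheb_rec (Suc (Suc n)) = X * T' - T" "cheb_second (Suc (Suc n)) = X * U' - U"
      by (simp_all add: X_def T_def U_def T'_def U'_def)
    have "2 * (2 * (X * T' - T)) = 2 * (X * T' + (X ^ 2 - 4) * U')"
      using IH by algebra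
    moreover have "2 * (2 * (X * U' - U)) = 2 * (T' + X * U')"
      using IH by algebra
    moreover have "a = b" if "2 * a = 2 * b" for a b :: "'a poly" using that by simp
    ultimately show ?case unfolding rec T'_def[symmetric] U'_def[symmetric] by blast
  qed
  then show ?thesis by (simp only: X_def)
qed

lemma cheb_derivatives:
  "pderiv (cheb_rec n :: 'a::field_char_0 poly) = of_nat n * cheb_second n \<and>
   ([:0, 1:] ^ 2 - 4) * pderiv (cheb_second n) = of_nat n * cheb_rec n - [:0, 1:] * (cheb_second n :: 'a poly)"
proof -
  define X :: "'a poly" where "X = [:0, 1:]"
  have dX: "pderiv X = 1" by (simp add: X_def pderiv_pCons)
  have d2: "pderiv (2 * p) = 2 * pderiv p" for p :: "'a poly" by (simp add: pderiv_mult)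
  have "pderiv (cheb_rec n :: 'a poly) = of_nat n * cheb_second n \<and>
    (X ^ 2 - 4) * pderiv (cheb_second n) = of_nat n * cheb_rec n - X * cheb_second n"
  proof (induction n)
    case 0
    show ?case by (simp add: pderiv_pCons)
  next
    case (Suc n)
    define T U T' U' where "T = (cheb_rec n :: 'a poly)" and "U = (cheb_second n :: 'a poly)"
      and "T' = (cheb_rec (Suc n) :: 'a poly)" and "U' = (cheb_second (Suc n) :: 'a poly)"
    define N where "N = (of_nat n :: 'a poly)"
    have IH: "pderiv T = N * U" "(X ^ 2 - 4) * pderiv U = N * T - X * U"
      using Suc unfolding T_def U_def N_def by blast+
    have add: "2 * T' = X * T + (X ^ 2 - 4) * U" "2 * U' = T + X * U"
      using cheb_addition[of n, where 'a = 'a] by (simp_all only: T_def U_def T'_def U'_def X_def)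
    have "2 * pderiv T' = T + X * pderiv T + (2 * X * U + (X ^ 2 - 4) * pderiv U)"
      unfolding d2[symmetric] add by (simp add: pderiv_add pderiv_mult pderiv_diff power2_eq_square dX algebra_simps)
    then have "2 * pderiv T' = 2 * ((N + 1) * U')" using IH add by algebra
    then have 1: "pderiv T' = (N + 1) * U'" by simp
    have "2 * pderiv U' = pderiv T + (U + X * pderiv U)"
      unfolding d2[symmetric] add by (simp add: pderiv_add pderiv_mult dX algebra_simps)
    then have "2 * ((X ^ 2 - 4) * pderiv U') = 2 * ((N + 1) * T' - X * U')" using IH add by algebra
    moreover have "a = b" if "2 * a = 2 * b" for a b :: "'a poly" using that by simp
    ultimately have 2: "(X ^ 2 - 4) * pderiv U' = (N + 1) * T' - X * U'" by blast
    show ?case using 1 2 by (simp add: T'_def U'_def N_def add.commute)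
  qed
  then show ?thesis by (simp only: X_def)
qed

text \<open>
  Chebyshev's differential equation, rescaled so that its finite singular points are \<open>2\<close> and \<open>-2\<close>.
\<close>

definition cheb_ode :: "nat \<Rightarrow> 'a::field poly \<Rightarrow> bool"
  where "cheb_ode n p \<longleftrightarrow>
    of_nat (n ^ 2) * p = [:0, 1:] * pderiv p + ([:0, 1:] ^ 2 - 4) * pderiv (pderiv p)"

lemma cheb_ode_cheb_rec: "cheb_ode n (cheb_rec n :: 'a::field_char_0 poly)"
proof -
  define X :: "'a poly" where "X = [:0, 1:]"
  define T U N where "T = (cheb_rec n :: 'a poly)" and "U = (cheb_second n :: 'a poly)" and "N = (of_nat n :: 'a poly)"
  have d: "pderiv T = N * U" "(X ^ 2 - 4) * pderiv U = N * T - X * U"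
    using cheb_derivatives[of n, where 'a = 'a] unfolding T_def U_def N_def X_def by blast+
  have "pderiv (pderiv T) = N * pderiv U" unfolding d(1) by (simp add: pderiv_mult N_def)
  then have "N ^ 2 * T = X * pderiv T + (X ^ 2 - 4) * pderiv (pderiv T)" using d by algebra
  then show ?thesis by (simp add: cheb_ode_def T_def X_def N_def)
qed

text \<open>
  Comparing coefficients of \<open>x\<^sup>k\<close> for \<open>k = deg p\<close> gives \<open>n\<^sup>2 = k\<^sup>2\<close>. So a solution of degree \<open>n\<close> is determined
  by its leading coefficient.
\<close>

lemma cheb_ode_unique:
  fixes p :: "'a::field_char_0 poly"
  assumes ode: "cheb_ode n p" and deg: "degree p < n"
  shows "p = 0"
proof (rule ccontr)
  assume "p \<noteq> 0"
  define k where "k = degree p"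
  have X: "[:0, 1:] * q = pCons 0 q" for q :: "'a poly" by simp
  have "of_nat (n ^ 2) * p = [:0, 1:] * pderiv p + ([:0, 1:] * ([:0, 1:] * pderiv (pderiv p)) - 4 * pderiv (pderiv p))"
    using ode unfolding cheb_ode_def by (simp only: power2_eq_square left_diff_distrib mult.assoc)
  then have "coeff (of_nat (n ^ 2) * p) k =
     coeff (pCons 0 (pderiv p) + (pCons 0 (pCons 0 (pderiv (pderiv p))) - 4 * pderiv (pderiv p))) k"
    unfolding X by (rule arg_cong)
  moreover have "coeff (of_nat (n ^ 2) * p) k = of_nat (n ^ 2) * coeff p k"
    by (simp add: of_nat_poly)
  moreover have "coeff (4 * pderiv (pderiv p)) k = 0"
    by (simp add: numeral_poly coeff_pderiv coeff_eq_0 k_def)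
  moreover have "coeff (pCons 0 (pderiv p)) k = of_nat k * coeff p k"
    by (cases k) (simp_all add: coeff_pderiv)
  moreover have "coeff (pCons 0 (pCons 0 (pderiv (pderiv p)))) k = of_nat (k * (k - 1)) * coeff p k"
    by (cases k; cases "k - 1") (auto simp: coeff_pderiv coeff_pCons algebra_simps)
  ultimately have "of_nat (n ^ 2) * coeff p k = of_nat k * coeff p k + of_nat (k * (k - 1)) * coeff p k"
    by simp
  then have "of_nat (n ^ 2) * coeff p k = of_nat (k + k * (k - 1)) * coeff p k"
    by (simp only: of_nat_add distrib_right)
  then have "n ^ 2 = k + k * (k - 1)" using \<open>p \<noteq> 0\<close> by (simp only: k_def mult_cancel_right leading_coeff_0_iff of_nat_eq_iff) simp
  also have "\<dots> = k ^ 2" by (cases k) (simp_all add: power2_eq_square)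
  finally have "n = k" by simp
  then show False using deg by (simp add: k_def)
qed

lemma degree_diff_const: "degree f > 0 \<Longrightarrow> degree (f - [:c:]) = degree f"
  for f :: "'a::field poly"
  using degree_diff_monom[of 0 f c] by (simp add: monom_0)

lemma lead_coeff_diff_const: "degree f > 0 \<Longrightarrow> lead_coeff (f - [:c:]) = lead_coeff f"
  for f :: "'a::field poly"
  by (subst degree_diff_const) (auto simp: coeff_pCons split: nat.split)

lemma order_diff_const: "degree f > 0 \<Longrightarrow> order x (f - [:c:]) = (if poly f x = c then ram f x else 0)"
  for f :: "'a::field poly"
  using diff_const_nonzero[of f c] by (auto simp: ram_def order_eq_0_iff)

lemma poly_eq_of_orders:
  fixes p q :: "'a::alg_closed_field poly"
  assumes "p \<noteq> 0" "q \<noteq> 0" "lead_coeff p = lead_coeff q" "\<And>x. order x p = order x q"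
  shows "p = q"
proof -
  have "proots p = proots q" by (rule multiset_eqI) (simp add: assms)
  then show ?thesis using size_proots_alg_closed(1)[OF assms(1)] size_proots_alg_closed(1)[OF assms(2)] assms(3)
    by metis
qed

lemma lead_coeff_cheb_rec: "n > 0 \<Longrightarrow> lead_coeff (cheb_rec n :: 'a::field poly) = 1"
proof -
  have "coeff (cheb_rec (Suc n) :: 'a poly) (Suc n) = 1 \<and> coeff (cheb_rec (Suc (Suc n)) :: 'a poly) (Suc (Suc n)) = 1" for n
    by (induction n) (simp_all add: coeff_eq_0 degree_cheb_rec)
  then show "n > 0 \<Longrightarrow> lead_coeff (cheb_rec n :: 'a::field poly) = 1"
    by (cases n) (auto simp: degree_cheb_rec)
qed

text \<open>
  The portrait determines the zeros of \<open>g\<^sup>2 - 4\<close> and of \<open>g'\<close> with multiplicities, which gives the Pell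
  type equation \<open>d\<^sup>2 (g\<^sup>2 - 4) = (x\<^sup>2 - 4) g'\<^sup>2\<close>. Differentiating it and cancelling \<open>2 g'\<close> leaves Chebyshev's
  differential equation. Hence \<open>g\<close> is a multiple of \<open>T\<^sub>d\<close>, and the value at \<open>2\<close> fixes the sign.
\<close>

lemma cheb_of_ramification:
  fixes g :: "'a::{alg_closed_field,field_char_0} poly"
  assumes deg: "degree g = d" "d > 0"
    and inv: "poly g 2 \<in> {2, -2}" "poly g (-2) \<in> {2, -2}"
    and ram: "\<And>x. poly g x \<in> {2, -2} \<Longrightarrow> ram g x = (if x \<in> {2, -2} then 1 else 2)"
  shows "g = cheb_rec d \<or> g = - cheb_rec d"
proof -
  define X :: "'a poly" where "X = [:0, 1:]"
  have X: "degree X > 0" "ram X x = 1" "poly X x = x" "lead_coeff X = 1" for x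
    by (simp_all add: X_def ram_id)
  have g: "degree g > 0" using deg by simp
  have ne: "(2::'a) \<noteq> -2" by (simp add: eq_neg_iff_add_eq_0)
  have dg: "pderiv g \<noteq> 0" using pderiv_nonzero g .
  have lead: "lead_coeff (pderiv g) = of_nat d * lead_coeff g"
    using deg by (simp add: degree_pderiv coeff_pderiv)
  have d0: "(of_nat d :: 'a) \<noteq> 0" using deg by simp
  have pell: "smult (of_nat d ^ 2) ((g - [:2:]) * (g - [:-2:])) = (X - [:2:]) * (X - [:-2:]) * (pderiv g) ^ 2"
  proof (rule poly_eq_of_orders)
    note nz = diff_const_nonzero[OF g] diff_const_nonzero[OF X(1)]
    show "smult (of_nat d ^ 2) ((g - [:2:]) * (g - [:-2:])) \<noteq> 0"
      using d0 nz by (simp only: smult_eq_0_iff mult_eq_0_iff power_eq_0_iff) blast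
    show "(X - [:2:]) * (X - [:-2:]) * (pderiv g) ^ 2 \<noteq> 0"
      using nz dg by (simp only: mult_eq_0_iff power_eq_0_iff) blast
    show "lead_coeff (smult (of_nat d ^ 2) ((g - [:2:]) * (g - [:-2:]))) =
        lead_coeff ((X - [:2:]) * (X - [:-2:]) * (pderiv g) ^ 2)"
      by (simp only: lead_coeff_smult lead_coeff_mult lead_coeff_power lead_coeff_diff_const[OF g]
          lead_coeff_diff_const[OF X(1)] X lead) (simp add: power2_eq_square algebra_simps)
    fix x
    have L: "order x (smult (of_nat d ^ 2) ((g - [:2:]) * (g - [:-2:]))) =
      (if poly g x = 2 then ram g x else 0) + (if poly g x = -2 then ram g x else 0)"
    proof -
      have "(g - [:2:]) * (g - [:-2:]) \<noteq> 0" using nz by (simp only: mult_eq_0_iff) blast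
      then have "order x ((g - [:2:]) * (g - [:-2:])) = order x (g - [:2:]) + order x (g - [:-2:])"
        by (rule order_mult)
      moreover have "(of_nat d :: 'a) ^ 2 \<noteq> 0" using d0 by simp
      then have "order x (smult (of_nat d ^ 2) ((g - [:2:]) * (g - [:-2:]))) = order x ((g - [:2:]) * (g - [:-2:]))"
        by (rule order_smult)
      ultimately show ?thesis by (simp only: order_diff_const[OF g])
    qed
    have R: "order x ((X - [:2:]) * (X - [:-2:]) * (pderiv g) ^ 2) =
      (if x = 2 then 1 else 0) + (if x = -2 then 1 else 0) + 2 * (ram g x - 1)"
    proof -
      have 1: "(X - [:2:]) * (X - [:-2:]) \<noteq> 0" using nz by (simp only: mult_eq_0_iff) blast
      then have "order x ((X - [:2:]) * (X - [:-2:])) = order x (X - [:2:]) + order x (X - [:-2:])"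
        by (rule order_mult)
      moreover have "order x ((X - [:2:]) * (X - [:-2:]) * (pderiv g) ^ 2) =
         order x ((X - [:2:]) * (X - [:-2:])) + order x ((pderiv g) ^ 2)"
        using 1 dg by (intro order_mult) (simp only: mult_eq_0_iff power_eq_0_iff, blast)
      ultimately show ?thesis
        by (simp only: order_diff_const[OF X(1)] X order_power[OF dg] order_pderiv_ram[OF g])
    qed
    have "ram g x = 1" if "poly g x \<notin> {2, -2}"
      by (rule cheb_like_unramified_elsewhere[OF g, of "{2, -2}"]) (use that ne inv ram in auto)
    moreover have "x \<notin> {2, -2}" if "poly g x \<notin> {2, -2}" using that inv by auto
    ultimately have "(if poly g x = 2 then ram g x else 0) + (if poly g x = -2 then ram g x else 0) =
        (if x = 2 then 1 else 0) + (if x = -2 then 1 else 0) + 2 * (ram g x - 1)"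
      using ram[of x] ne by (cases "poly g x \<in> {2, -2}"; cases "x \<in> {2, -2}") auto
    then show "order x (smult (of_nat d ^ 2) ((g - [:2:]) * (g - [:-2:]))) =
        order x ((X - [:2:]) * (X - [:-2:]) * (pderiv g) ^ 2)"
      unfolding L R .
  qed
  have two: "[:-2:] = (-2 :: 'a poly)" "[:2:] = (2 :: 'a poly)" by (simp_all add: numeral_poly)
  define N where "N = (of_nat (d ^ 2) :: 'a poly)"
  have pell': "N * (g ^ 2 - 4) = (X ^ 2 - 4) * (pderiv g) ^ 2"
  proof -
    have "smult (of_nat d ^ 2) p = N * p" for p :: "'a poly" by (simp add: N_def of_nat_poly flip: of_nat_power)
    with pell have "N * ((g - 2) * (g + 2)) = (X - 2) * (X + 2) * (pderiv g) ^ 2" by (simp add: two)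
    then show ?thesis by algebra
  qed
  have "pderiv (N * (g ^ 2 - 4)) = N * (2 * g * pderiv g)"
    by (simp add: pderiv_mult pderiv_diff power2_eq_square N_def algebra_simps)
  moreover have "pderiv ((X ^ 2 - 4) * (pderiv g) ^ 2) = 2 * X * (pderiv g) ^ 2 + (X ^ 2 - 4) * (2 * pderiv g * pderiv (pderiv g))"
    by (simp add: pderiv_mult pderiv_diff power2_eq_square X_def pderiv_pCons algebra_simps)
  ultimately have "N * (2 * g * pderiv g) = 2 * X * (pderiv g) ^ 2 + (X ^ 2 - 4) * (2 * pderiv g * pderiv (pderiv g))"
    using arg_cong[OF pell', of pderiv] by simp
  then have "(2 * pderiv g) * (N * g) = (2 * pderiv g) * (X * pderiv g + (X ^ 2 - 4) * pderiv (pderiv g))"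
    by algebra
  then have "N * g = X * pderiv g + (X ^ 2 - 4) * pderiv (pderiv g)" using dg by simp
  then have ode: "cheb_ode d g" by (simp only: cheb_ode_def N_def X_def)
  define c where "c = lead_coeff g"
  define T where "T = (cheb_rec d :: 'a poly)"
  have odeT: "cheb_ode d T" unfolding T_def by (rule cheb_ode_cheb_rec)
  have "g = smult c T"
  proof (rule ccontr)
    assume neq: "g \<noteq> smult c T"
    have "degree (g - smult c T) < d"
      by (rule degree_diff_less_of_coeff_eq)
         (use neq deg lead_coeff_cheb_rec[of d, where 'a = 'a] degree_smult_le[of c T] in \<open>auto simp: T_def degree_cheb_rec c_def\<close>)
    moreover have "cheb_ode d (g - smult c T)"
    proof -
      have s: "smult c p = [:c:] * p" for p :: "'a poly" by simp
      show ?thesis using ode odeT unfolding cheb_ode_def pderiv_diff pderiv_smult unfolding s by algebra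
    qed
    ultimately have "g - smult c T = 0" using cheb_ode_unique by blast
    then show False using neq by simp
  qed
  moreover have "poly T 2 = 2" using poly_cheb_rec[of "1 :: 'a" d] by (simp add: T_def)
  ultimately have "c * 2 \<in> {2, -2}" using inv(1) by simp
  then have "c = 1 \<or> c = -1" by auto
  then show ?thesis using \<open>g = smult c T\<close> by (auto simp: T_def)
qed

text \<open>
  An affine change of coordinates moves the exceptional pair to \<open>{2, -2}\<close>.
\<close>

lemma cheb_like_imp_linearly_conjugate:
  fixes f :: "'a::{alg_closed_field,field_char_0} poly"
  assumes deg: "degree f > 0" and "cheb_like f"
  shows "linearly_conjugate f (chebyshev (degree f)) \<or> linearly_conjugate f (- chebyshev (degree f))"
proof -
  obtain W where W: "card W = 2" "\<forall>x\<in>W. poly f x \<in> W"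
    "\<forall>x. poly f x \<in> W \<longrightarrow> ram f x = (if x \<in> W then 1 else 2)"
    using assms(2) unfolding cheb_like_def by blast
  obtain v w where vw: "W = {v, w}" "v \<noteq> w" using W(1) by (auto simp: card_2_iff)
  define c where "c = 4 / (v - w)"
  define m where "m = (v + w) / 2"
  define l l' where "l = [:- (c * m), c:]" and "l' = [:m, 1 / c:]"
  have c: "c \<noteq> 0" using vw by (simp add: c_def)
  have lv: "c * (v - m) = 2" "c * (w - m) = -2" using vw by (simp_all add: c_def m_def field_simps)
  have l: "poly l x = c * (x - m)" for x by (simp add: l_def algebra_simps)
  have l': "poly l' x = m + x / c" for x by (simp add: l'_def)
  have inv1: "pcompose l l' = [:0, 1:]" "pcompose l' l = [:0, 1:]"
    using c by (simp_all add: l_def l'_def pcompose_pCons)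
  have deg_l: "degree l = 1" "degree l' = 1" using c by (simp_all add: l_def l'_def)
  define g where "g = pcompose l (pcompose f l')"
  have dg: "degree g = degree f" by (simp add: g_def degree_pcompose deg_l)
  have pg: "poly g x = c * (poly f (poly l' x) - m)" for x by (simp add: g_def poly_pcompose l)
  have rg: "ram g x = ram f (poly l' x)" for x
    unfolding g_def using deg by (simp add: ram_pcompose degree_pcompose deg_l ram_linear)
  have memW: "c * (y - m) \<in> {2, -2} \<longleftrightarrow> y \<in> W" for y
  proof -
    have "c * (y - m) = c * (v - m) \<longleftrightarrow> y = v" "c * (y - m) = c * (w - m) \<longleftrightarrow> y = w" using c by auto
    then show ?thesis using lv vw by auto
  qed
  have memx: "x \<in> {2, -2} \<longleftrightarrow> poly l' x \<in> W" for x
    using memW[of "poly l' x"] c by (simp add: l')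
  have "g = cheb_rec (degree f) \<or> g = - cheb_rec (degree f)"
  proof (rule cheb_of_ramification[OF dg deg])
    show "poly g 2 \<in> {2, -2}" "poly g (-2) \<in> {2, -2}"
      unfolding pg memW using W(2) memx by blast+
    show "ram g x = (if x \<in> {2, -2} then 1 else 2)" if "poly g x \<in> {2, -2}" for x
    proof -
      have "poly f (poly l' x) \<in> W" using that unfolding pg memW .
      then show ?thesis using W(3) memx unfolding rg by simp
    qed
  qed
  moreover have "linearly_conjugate f g" unfolding linearly_conjugate_def g_def using inv1 deg_l by blast
  ultimately show ?thesis by (auto simp: chebyshev_eq_cheb_rec)
qed

lemma total_ramification_form:
  fixes f :: "'a::field poly"
  assumes deg: "degree f > 0" and ram: "ram f v = degree f"
  shows "\<exists>c. c \<noteq> 0 \<and> f = [:poly f v:] + smult c ([:- v, 1:] ^ degree f)"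
proof -
  define d w where "d = degree f" and "w = poly f v"
  have ne: "f - [:w:] \<noteq> 0" using diff_const_nonzero[OF deg] .
  have "[:- v, 1:] ^ d dvd f - [:w:]" using ram order_1[of v "f - [:w:]"] by (simp add: ram_def d_def w_def)
  then obtain q where q: "f - [:w:] = [:- v, 1:] ^ d * q" by (elim dvdE)
  have "degree ([:- v, 1:] ^ d * q) = d + degree q"
    using ne q by (subst degree_mult_eq) (auto simp: degree_power_eq)
  then have "degree q = 0" using q degree_diff_const[OF deg, of w] by (simp add: d_def)
  then obtain c where c: "q = [:c:]" by (metis degree_0_id)
  have c0: "c \<noteq> 0" using ne q c by auto
  have "f = [:w:] + smult c ([:- v, 1:] ^ d)" using q c by (simp add: algebra_simps)
  then show ?thesis using c0 unfolding d_def w_def by blast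
qed

lemma power_like_imp_linearly_conjugate:
  fixes f :: "'a::{alg_closed_field,field_char_0} poly"
  assumes deg: "degree f \<ge> 2" and "power_like f"
  shows "linearly_conjugate f (monom 1 (degree f))"
proof -
  define d where "d = degree f"
  obtain v where v: "poly f v = v" "ram f v = d" using assms(2) by (auto simp: power_like_def d_def)
  have deg0: "degree f > 0" using deg by simp
  obtain c where c0: "c \<noteq> 0" and f: "f = [:v:] + smult c ([:- v, 1:] ^ d)"
    using total_ramification_form[OF deg0, of v] v by (auto simp: d_def)
  \<comment> \<open>Conjugation by the homothety with factor \<open>k\<close> divides the leading coefficient by \<open>k\<close> to the power
    \<open>d - 1\<close>.\<close>
  obtain k where k: "k ^ (d - 1) = c" using nth_root_exists[of "d - 1" c] deg by (auto simp: d_def)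
  have k0: "k \<noteq> 0" using k c0 deg by (auto simp: d_def power_0_left)
  define l l' where "l = [:- (k * v), k:]" and "l' = [:v, 1 / k:]"
  have inv1: "pcompose l l' = [:0, 1:]" "pcompose l' l = [:0, 1:]"
    using k0 by (simp_all add: l_def l'_def pcompose_pCons)
  have deg_l: "degree l = 1" using k0 by (simp add: l_def)
  have "pcompose l (pcompose f l') = monom 1 d"
  proof (rule poly_eq_poly_eq_iff[THEN iffD1], rule ext)
    fix x
    have "poly (pcompose l (pcompose f l')) x = k * (c * (x / k) ^ d)"
      by (simp add: poly_pcompose l_def l'_def f algebra_simps)
    also have "\<dots> = x ^ d"
    proof -
      have "k ^ d = k * c" using k deg by (metis d_def Suc_diff_le Suc_1 diff_Suc_1 le_trans one_le_numeral power_Suc)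
      then show ?thesis using k0 c0 by (simp add: power_divide)
    qed
    finally show "poly (pcompose l (pcompose f l')) x = poly (monom 1 d) x" by (simp add: poly_monom)
  qed
  then show ?thesis unfolding linearly_conjugate_def d_def[symmetric] using inv1 deg_l by metis
qed

lemma disintegratedD:
  fixes f :: "'a::{alg_closed_field,field_char_0} poly"
  assumes "disintegrated f"
  shows "degree f \<ge> 2" "\<not> cheb_like f" "\<not> power_like f"
proof -
  show 1: "degree f \<ge> 2" using assms by (simp add: disintegrated_def)
  then show "\<not> cheb_like f" "\<not> power_like f"
    using assms cheb_like_imp_linearly_conjugate[of f] power_like_imp_linearly_conjugate[of f]
    by (auto simp: disintegrated_def)
qed

section \<open>Intertwiners of coprime degree\<close>

lemma ex_power_of_orders:
  fixes P :: "'a::alg_closed_field poly"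
  assumes "P \<noteq> 0" "a > 0" "\<And>x. a dvd order x P"
  shows "\<exists>Q. P = Q ^ a"
  using assms(1,3)
proof (induction "degree P" arbitrary: P rule: less_induct)
  case less
  show ?case
  proof (cases "degree P = 0")
    case True
    then obtain c where c: "P = [:c:]" by (metis degree_0_id)
    obtain k where "k ^ a = c" using nth_root_exists[OF assms(2), of c] by auto
    then have "P = [:k:] ^ a" using c by (simp add: poly_const_pow)
    then show ?thesis ..
  next
    case False
    then obtain x where x: "poly P x = 0" using alg_closed_imp_poly_has_root[of P] by auto
    then have "order x P \<noteq> 0" using order_root[of P x] less.prems(1) by blast
    then have "a \<le> order x P" using less.prems(2)[of x] by (intro dvd_imp_le) auto
    then have "[:- x, 1:] ^ a dvd P" using order_divides[of x a P] by blast
    then obtain R where R: "P = [:- x, 1:] ^ a * R" by (elim dvdE)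
    have R0: "R \<noteq> 0" using R less.prems(1) by auto
    have "degree P = a + degree R"
      unfolding R using R0 by (subst degree_mult_eq) (simp_all add: degree_power_eq)
    then have "degree R < degree P" using assms(2) by simp
    moreover have "a dvd order y R" for y
    proof -
      have "order y P = a * order y [:- x, 1:] + order y R"
        unfolding R using R0 by (subst order_mult) (simp_all add: order_power)
      then show ?thesis using less.prems(2)[of y] by (metis dvd_add_right_iff dvd_triv_left)
    qed
    ultimately obtain Q where "R = Q ^ a" using less.hyps R0 by blast
    then have "P = ([:- x, 1:] * Q) ^ a" using R by (simp only: power_mult_distrib)
    then show ?thesis ..
  qed
qed

lemma power_eq_imp_smult:
  fixes A B :: "'a::alg_closed_field poly"
  assumes "A ^ a = B ^ a" "a > 0" "B \<noteq> 0"
  shows "\<exists>\<xi>. \<xi> ^ a = 1 \<and> A = smult \<xi> B"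
proof -
  have A: "A \<noteq> 0" using assms by (metis power_eq_0_iff)
  define \<xi> where "\<xi> = lead_coeff A / lead_coeff B"
  have nz: "lead_coeff A \<noteq> 0" "lead_coeff B \<noteq> 0" "\<xi> \<noteq> 0" using A assms(3) by (simp_all add: \<xi>_def)
  have "lead_coeff A ^ a = lead_coeff B ^ a" using assms(1) by (metis lead_coeff_power)
  then have "\<xi> ^ a = 1" using nz by (simp add: \<xi>_def power_divide)
  moreover have "A = smult \<xi> B"
  proof (rule poly_eq_of_orders)
    fix x
    have "order x (A ^ a) = order x (B ^ a)" using assms(1) by (rule arg_cong)
    then have "a * order x A = a * order x B" by (simp only: order_power[OF A] order_power[OF assms(3)])
    then show "order x A = order x (smult \<xi> B)" using assms(2) nz by (simp add: order_smult)
  qed (use A assms nz in \<open>simp_all add: \<xi>_def\<close>)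
  ultimately show ?thesis by blast
qed

text \<open>
  Write \<open>F = f\<^sup>M\<close> and let \<open>V\<close> be the set of branch values of \<open>p\<close>. The pairs \<open>(x, y)\<close> with \<open>F(x) = p(y)\<close> all
  arise as \<open>(p(t), \<eta>(t))\<close>, and the indices satisfy \<open>e\<^sub>F(x) e\<^sub>p(t) = e\<^sub>p(y) e\<^sub>\<eta>(t)\<close>. Two consequences make \<open>V\<close>
  a set as in \<open>cheb_like_criterion\<close>: if \<open>x\<close> is not in \<open>V\<close>, then \<open>e\<^sub>p(y)\<close> divides \<open>e\<^sub>F(x)\<close>; and if \<open>F(x)\<close> is
  not in \<open>V\<close>, then its \<open>a\<close> preimages under \<open>p\<close> lift to \<open>a\<close> distinct points over \<open>x\<close>, so \<open>x\<close> is not in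
  \<open>V\<close> either. As \<open>f\<close> is not of Chebyshev type, \<open>V\<close> is a single point, over which \<open>p\<close> is totally
  ramified. The statements about \<open>f\<close> instead of \<open>F\<close> come from \<open>ram_iterate_witness\<close> with \<open>m = a\<close>.
\<close>

lemma coprime_intertwiner_ramification:
  fixes f p \<eta> :: "'a::{alg_closed_field,field_char_0} poly"
  assumes deg: "degree f \<ge> 2" and M: "M > 0"
    and inter: "pcompose (poly_iter f M) p = pcompose p \<eta>"
    and a: "degree p \<ge> 2" "coprime (degree p) (degree f)"
    and cheb: "\<not> cheb_like f"
  shows "\<exists>v t c. c \<noteq> 0 \<and> p = [:v:] + smult c ([:- t, 1:] ^ degree p) \<and> poly f v = v \<and>
     (\<forall>x. poly f x = v \<longrightarrow> x \<noteq> v \<longrightarrow> degree p dvd ram f x)"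
proof -
  define F D a where "F = poly_iter f M" and "D = degree f ^ M" and "a = degree p"
  have degF: "degree F = D" by (simp add: F_def D_def degree_poly_iter)
  have D: "D \<ge> 2" using deg M unfolding D_def by (metis le_trans self_le_power Suc_1 Suc_leD)
  have a2: "a \<ge> 2" using a(1) by (simp add: a_def)
  have deg\<eta>: "degree \<eta> = D"
    using arg_cong[OF inter, of degree] a2 degF by (simp add: degree_pcompose F_def a_def)
  have cop: "coprime a D" using a(2) by (simp add: a_def D_def)
  have pos: "degree F > 0" "degree p > 0" "degree \<eta> > 0" using degF D a2 deg\<eta> by (simp_all add: a_def)
  have inter': "pcompose F p = pcompose p \<eta>" using inter by (simp add: F_def)
  have pt: "poly F (poly p t) = poly p (poly \<eta> t)" for t
    using arg_cong[OF inter', of "\<lambda>q. poly q t"] by (simp add: poly_pcompose)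
  have rt: "ram F (poly p t) * ram p t = ram p (poly \<eta> t) * ram \<eta> t" for t
    using arg_cong[OF inter', of "\<lambda>q. ram q t"] ram_pcompose[OF pos(1,2)] ram_pcompose[OF pos(2,3)] by simp
  have lift: "\<exists>t. poly p t = x \<and> poly \<eta> t = y" if "poly F x = poly p y" for x y
    by (rule fibre_product_parametrised[OF inter']) (use degF deg\<eta> cop a2 D that in \<open>auto simp: a_def\<close>)
  have rp: "ram p t \<ge> 1" for t using ram_pos[OF pos(2), of t] by simp
  define C V where "C = {t. ram p t \<ge> 2}" and "V = poly p ` C"
  have dp: "pderiv p \<noteq> 0" using pderiv_nonzero pos(2) .
  have C: "C = {t. poly (pderiv p) t = 0}"
    using order_pderiv_ram[OF pos(2)] order_root[of "pderiv p"] dp rp by (force simp: C_def)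
  have finC: "finite C" unfolding C using dp by (rule poly_roots_finite)
  have "degree (pderiv p) > 0" using a2 by (simp add: degree_pderiv a_def)
  then have C0: "C \<noteq> {}" unfolding C using alg_closed_imp_poly_has_root by blast
  have finV: "finite V" and V0: "V \<noteq> {}" using finC C0 by (simp_all add: V_def)
  have unram: "ram p t = 1" if "poly p t \<notin> V" for t
    using that rp[of t] by (force simp: V_def C_def)
  have outside: "ram p y dvd ram F x" if xy: "poly F x = poly p y" "x \<notin> V" for x y
  proof -
    obtain t where t: "poly p t = x" "poly \<eta> t = y" using lift[OF xy(1)] by blast
    then have "ram F x = ram p y * ram \<eta> t" using rt[of t] unram[of t] xy(2) by simp
    then show ?thesis by simp
  qed
  have invV: "poly F x \<in> V" if "x \<in> V" for x
  proof (rule ccontr)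
    assume notV: "poly F x \<notin> V"
    let ?Y = "{y. poly p y = poly F x}" and ?T = "{t. poly p t = x}"
    have fin: "finite ?T" "finite ?Y" using finite_fibre[OF pos(2), of "{x}"] finite_fibre[OF pos(2), of "{poly F x}"] by simp_all
    have "a = (\<Sum>y\<in>?Y. ram p y)" using sum_ram_fibre[OF pos(2)] by (simp add: a_def)
    also have "\<dots> = (\<Sum>y\<in>?Y. 1)" using unram notV by (intro sum.cong) auto
    finally have "a = card ?Y" by simp
    also have "?Y \<subseteq> poly \<eta> ` ?T"
    proof
      fix y assume "y \<in> ?Y"
      then obtain t where "poly p t = x" "poly \<eta> t = y" using lift[of x y] by auto
      then show "y \<in> poly \<eta> ` ?T" by auto
    qed
    then have "card ?Y \<le> card ?T" using fin by (meson card_image_le card_mono finite_imageI le_trans)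
    finally have "(\<Sum>t\<in>?T. ram p t) \<le> (\<Sum>t\<in>?T. 1)" using sum_ram_fibre[OF pos(2), of x] by (simp add: a_def)
    then have "ram p t = 1" if "t \<in> ?T" for t
      using sum_eq_pointwise[of ?T "\<lambda>_. 1" "ram p" t] fin rp that by simp
    moreover obtain t where "t \<in> C" "poly p t = x" using \<open>x \<in> V\<close> by (auto simp: V_def)
    ultimately show False by (force simp: C_def)
  qed
  have "card V < 2"
  proof (rule ccontr)
    assume "\<not> card V < 2"
    moreover have "ram F x \<ge> 2" if x: "poly F x \<in> V" "x \<notin> V" for x
    proof -
      obtain y where y: "poly F x = poly p y" "ram p y \<ge> 2" using x(1) by (auto simp: V_def C_def)
      have "ram p y \<le> ram F x" using outside[OF y(1) x(2)] ram_pos[OF pos(1), of x] by (rule dvd_imp_le)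
      then show ?thesis using y by simp
    qed
    ultimately have "cheb_like F" using cheb_like_criterion[of F V] degF D finV invV by simp
    then show False using cheb cheb_like_of_iterate deg M unfolding F_def by blast
  qed
  moreover have "card V > 0" using finV V0 by (simp add: card_gt_0_iff)
  ultimately have "card V = 1" by simp
  then obtain v where v: "V = {v}" by (auto simp: card_1_singleton_iff)
  let ?T = "{t. poly p t = v}"
  have finT: "finite ?T" using finite_fibre[OF pos(2), of "{v}"] by simp
  have CT: "C \<subseteq> ?T" using v by (auto simp: V_def)
  have "a - 1 = (\<Sum>t\<in>C. order t (pderiv p))"
    using sum_order_eq_degree[OF dp] by (simp add: C degree_pderiv a_def)
  also have "\<dots> = (\<Sum>t\<in>C. ram p t - 1)" by (simp add: order_pderiv_ram[OF pos(2)])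
  also have "\<dots> \<le> (\<Sum>t\<in>?T. ram p t - 1)" by (rule sum_mono2[OF finT CT]) simp
  finally have "a - 1 + card ?T \<le> (\<Sum>t\<in>?T. (ram p t - 1) + 1)" by (simp only: sum.distrib) simp
  also have "\<dots> = (\<Sum>t\<in>?T. ram p t)" using rp by (intro sum.cong) (simp_all only: le_add_diff_inverse2)
  also have "\<dots> = a" using sum_ram_fibre[OF pos(2)] by (simp add: a_def)
  finally have "card ?T \<le> 1" using a2 by simp
  moreover obtain t where t: "t \<in> C" using C0 by blast
  ultimately have T: "?T = {t}" using CT finT by (intro card_seteq[symmetric]) auto
  then have ramt: "ram p t = a" using sum_ram_fibre[OF pos(2), of v] by (simp add: a_def)
  have pv: "poly p t = v" using T by blast
  obtain c where c: "c \<noteq> 0" "p = [:v:] + smult c ([:- t, 1:] ^ degree p)"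
    using total_ramification_form[OF pos(2), of t] ramt pv by (auto simp: a_def)
  have Fv: "poly F v = v" using invV v by simp
  have dvdF: "a dvd ram F x" if "poly F x = v" "x \<noteq> v" for x
    using outside[of x t] that v pv ramt by simp
  \<comment> \<open>Otherwise \<open>a\<close> would divide all indices over \<open>v\<close>, hence their sum \<open>D\<close>.\<close>
  have not_dvd: "\<not> a dvd ram F v"
  proof
    assume "a dvd ram F v"
    then have "a dvd ram F x" if "poly F x = v" for x using dvdF[OF that] by (cases "x = v") simp_all
    then have "a dvd (\<Sum>x | poly F x = v. ram F x)" by (intro dvd_sum) simp
    then have "a dvd D" using sum_ram_fibre[OF pos(1)] degF by simp
    then have "a = 1" using cop by (metis coprime_absorb_left nat_dvd_1_iff_1)
    then show False using a2 by simp
  qed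
  have VM: "V = {y. poly (poly_iter f M) y \<in> V \<and> \<not> a dvd ram (poly_iter f M) y}"
    unfolding F_def[symmetric] using v Fv dvdF not_dvd by auto
  have "degree f > 0" using deg by simp
  from ram_iterate_witness[OF this finV M a2 VM] obtain W where
    W: "finite W" "V \<subseteq> W" "\<forall>x\<in>W. poly f x \<in> W" "\<forall>x. poly f x \<in> W \<longrightarrow> x \<notin> W \<longrightarrow> ram f x \<ge> 2"
      "\<forall>x. poly f x \<in> V \<longrightarrow> \<not> a dvd ram f x \<longrightarrow> x \<in> W"
    by blast
  have "card W < 2" using cheb_like_criterion[of f W] W deg cheb by force
  then have Wv: "W = {v}" using W(1,2) v card_seteq[of W "{v}"] by simp
  have "poly f v = v" using W(3) Wv by simp
  moreover have "\<forall>x. poly f x = v \<longrightarrow> x \<noteq> v \<longrightarrow> degree p dvd ram f x"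
    using W(5) Wv v by (auto simp: a_def)
  ultimately show ?thesis using c by blast
qed

text \<open>
  Apply \<open>ritt_lcm\<close> to \<open>f \<circ> (f\<close>\<open>\<^sup>M\<^sup>-\<^sup>1 \<circ> p) = p \<circ> \<eta>\<close>: the right factors have degrees \<open>a \<delta>\<close>\<open>\<^sup>M\<^sup>-\<^sup>1\<close> and \<open>\<delta>\<^sup>M\<close>, so the
  common left factor \<open>U\<close> of \<open>f\<close> and \<open>p\<close> has degree \<open>gcd a \<delta>\<close>. With \<open>f = U \<circ> S\<close> and \<open>p = U \<circ> T\<close>, the pair
  \<open>S \<circ> U\<close> and \<open>T\<close> satisfies the same hypotheses for the same \<open>\<eta>\<close>, and \<open>T\<close> has smaller degree unless
  that gcd is 1.
\<close>

lemma reduce_to_coprime: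
  fixes f p \<eta> :: "'a::{alg_closed_field,field_char_0} poly"
  assumes "degree f \<ge> 2" "M > 0" "pcompose (poly_iter f M) p = pcompose p \<eta>" "degree p > 0"
    "\<not> cheb_like f" "\<not> power_like f"
  shows "\<exists>f' u p'. degree f' = degree f \<and> degree u > 0 \<and> pcompose f u = pcompose u f' \<and>
    pcompose (poly_iter f' M) p' = pcompose p' \<eta> \<and> degree p' > 0 \<and> coprime (degree p') (degree f) \<and>
    \<not> cheb_like f' \<and> \<not> power_like f'"
  using assms
proof (induction "degree p" arbitrary: f p rule: less_induct)
  case less
  define \<delta> a where "\<delta> = degree f" and "a = degree p"
  have pos: "\<delta> > 0" "a > 0" using less.prems by (simp_all add: \<delta>_def a_def)
  show ?case
  proof (cases "coprime a \<delta>")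
    case True
    have "pcompose f [:0, 1:] = pcompose [:0, 1:] f" by simp
    then show ?thesis using less.prems True
      by (intro exI[of _ f] exI[of _ "[:0, 1:]"] exI[of _ p]) (simp add: a_def \<delta>_def)
  next
    case False
    define e where "e = gcd a \<delta>"
    have e: "e > 1" using False pos by (metis e_def coprime_iff_gcd_eq_1 gcd_eq_0_iff less_one linorder_neqE_nat not_gr_zero)
    obtain K where K: "M = Suc K" using less.prems(2) by (cases M) auto
    define P where "P = pcompose (poly_iter f K) p"
    have AB: "pcompose f P = pcompose p \<eta>"
      using less.prems(3) by (simp add: P_def K poly_iter_Suc pcompose_assoc)
    have degP: "degree P = a * \<delta> ^ K" by (simp add: P_def degree_pcompose degree_poly_iter a_def \<delta>_def)
    have deg\<eta>: "degree \<eta> = \<delta> * \<delta> ^ K"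
    proof -
      have "\<delta> * (a * \<delta> ^ K) = a * degree \<eta>"
        using arg_cong[OF AB, of degree] degP by (simp only: degree_pcompose a_def \<delta>_def)
      then have "a * (\<delta> * \<delta> ^ K) = a * degree \<eta>" by (simp only: mult_ac)
      then show ?thesis using pos by simp
    qed
    have gcdP: "gcd (degree P) (degree \<eta>) = e * \<delta> ^ K"
      unfolding degP deg\<eta> e_def by (simp only: gcd_mult_right mult.commute[of _ "\<delta> ^ K"] gcd_mult_distrib_nat)
    obtain U S T where UST: "f = pcompose U S" "p = pcompose U T" "pcompose S P = pcompose T \<eta>"
      and dS: "degree S = degree \<eta> div gcd (degree P) (degree \<eta>)"
      and dT: "degree T = degree P div gcd (degree P) (degree \<eta>)"
      using ritt_lcm[OF AB] pos degP deg\<eta> unfolding a_def \<delta>_def by auto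
    have dS': "degree S = \<delta> div e" and dT': "degree T = a div e"
      using dS dT pos unfolding gcdP by (simp_all add: degP deg\<eta>)
    have eS: "degree S * e = \<delta>" and eT: "degree T * e = a"
      unfolding dS' dT' e_def by simp_all
    have degU: "degree U = e" using UST(1) eS pos by (metis \<delta>_def degree_pcompose mult.commute mult_cancel1 mult_is_0 neq0_conv)
    have posST: "degree S > 0" "degree T > 0" "degree U > 0" using eS eT pos e degU by (auto intro: gr0I)
    define f1 where "f1 = pcompose S U"
    have degf1: "degree f1 = degree f" by (simp add: f1_def UST(1) degree_pcompose mult.commute)
    have fU: "pcompose f U = pcompose U f1" by (simp add: f1_def UST(1) pcompose_assoc)
    have "pcompose (poly_iter f1 M) T = pcompose S (pcompose U (pcompose (poly_iter f1 K) T))"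
      by (simp add: K poly_iter_Suc f1_def pcompose_assoc)
    also have "pcompose U (pcompose (poly_iter f1 K) T) = P"
      using poly_iter_intertwine[OF fU, of K] by (simp add: P_def UST(2) pcompose_assoc)
    finally have inter: "pcompose (poly_iter f1 M) T = pcompose T \<eta>" using UST(3) by simp
    have "degree T < degree p" using eT e posST(2) unfolding a_def
      by (metis mult.right_neutral mult_less_cancel1)
    moreover have "\<not> cheb_like f1"
    proof
      assume "cheb_like f1"
      have "degree S * degree U \<ge> 2" using less.prems(1) eS degU by (simp add: \<delta>_def)
      from cheb_like_swap[OF posST(1,3) this] \<open>cheb_like f1\<close> have "cheb_like (pcompose U S)"
        by (simp add: f1_def)
      then show False using less.prems(5) UST(1) by blast
    qed
    moreover have "\<not> power_like f1"
      using power_like_swap[OF posST(1,3)] less.prems(6) unfolding f1_def UST(1) by blast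
    ultimately obtain f' u p' where IH: "degree f' = degree f1" "degree u > 0" "pcompose f1 u = pcompose u f'"
      "pcompose (poly_iter f' M) p' = pcompose p' \<eta>" "degree p' > 0" "coprime (degree p') (degree f1)"
      "\<not> cheb_like f'" "\<not> power_like f'"
      using less.hyps[of T f1] less.prems(1,2) degf1 inter posST(2) by auto
    have "pcompose f (pcompose U u) = pcompose (pcompose U u) f'"
      by (metis IH(3) fU pcompose_assoc)
    moreover have "degree (pcompose U u) > 0" using IH(2) posST(3) by (simp add: degree_pcompose)
    ultimately show ?thesis using IH degf1 by (intro exI[of _ f'] exI[of _ "pcompose U u"] exI[of _ p']) simp
  qed
qed

section \<open>Centred polynomials and common iterates\<close>

lemma coeff_power_second:
  fixes B :: "'a::idom poly"
  assumes m: "degree B = m" "m > 0"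
  shows "coeff (B ^ Suc k) (Suc k * m - 1) = of_nat (Suc k) * lead_coeff B ^ k * coeff B (m - 1)"
proof (induction k)
  case (Suc k)
  have B0: "B \<noteq> 0" using m by auto
  have top: "coeff (B ^ Suc k) (Suc k * m) = lead_coeff B ^ Suc k"
    using coeff_power_degree[of B "Suc k"] m by simp
  have "coeff (B ^ Suc (Suc k)) (Suc (Suc k) * m - 1) = (\<Sum>i\<le>Suc (Suc k) * m - 1. coeff B i * coeff (B ^ Suc k) (Suc (Suc k) * m - 1 - i))"
    by (simp only: power_Suc[of B "Suc k"] coeff_mult)
  also have "\<dots> = (\<Sum>i\<in>{m - 1, m}. coeff B i * coeff (B ^ Suc k) (Suc (Suc k) * m - 1 - i))"
  proof (rule sum.mono_neutral_right)
    show "{m - 1, m} \<subseteq> {..Suc (Suc k) * m - 1}" using m(2) by (auto simp: algebra_simps)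
    show "\<forall>i\<in>{..Suc (Suc k) * m - 1} - {m - 1, m}. coeff B i * coeff (B ^ Suc k) (Suc (Suc k) * m - 1 - i) = 0"
    proof
      fix i assume i: "i \<in> {..Suc (Suc k) * m - 1} - {m - 1, m}"
      show "coeff B i * coeff (B ^ Suc k) (Suc (Suc k) * m - 1 - i) = 0"
      proof (cases "i > m")
        case True
        then show ?thesis using m by (simp add: coeff_eq_0)
      next
        case False
        then have "Suc i < m" using i by auto
        then have "Suc (Suc k) * m - 1 - i > Suc k * m" by simp
        moreover have "degree (B ^ Suc k) = Suc k * m" using degree_power_eq[OF B0, of "Suc k"] m(1) by simp
        ultimately have "coeff (B ^ Suc k) (Suc (Suc k) * m - 1 - i) = 0" by (intro coeff_eq_0) simp
        then show ?thesis by simp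
      qed
    qed
  qed simp
  also have "\<dots> = coeff B (m - 1) * coeff (B ^ Suc k) (Suc k * m) + coeff B m * coeff (B ^ Suc k) (Suc k * m - 1)"
  proof -
    have "m + x - 1 - (m - 1) = x" "m + x - 1 - m = x - 1" for x
      using m(2) by linarith+
    then have "Suc (Suc k) * m - 1 - (m - 1) = Suc k * m" "Suc (Suc k) * m - 1 - m = Suc k * m - 1"
      unfolding mult_Suc[of "Suc k"] by blast+
    moreover have "(\<Sum>i\<in>{m - 1, m}. h i) = h (m - 1) + h m" for h :: "nat \<Rightarrow> 'a" using m(2) by simp
    ultimately show ?thesis by (simp only:)
  qed
  also have "\<dots> = of_nat (Suc (Suc k)) * lead_coeff B ^ Suc k * coeff B (m - 1)"
  proof -
    have "b * l ^ Suc k + l * (of_nat (Suc k) * l ^ k * b) = of_nat (Suc (Suc k)) * l ^ Suc k * b" for b l :: 'a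
      by (simp add: algebra_simps)
    moreover have "coeff B m = lead_coeff B" using m(1) by simp
    ultimately show ?thesis unfolding Suc top by (simp only:)
  qed
  finally show ?case .
qed (use m in simp)

text \<open>
  The second coefficient of a composition comes from the top power of \<open>B\<close> alone unless \<open>B\<close> is
  affine.
\<close>

lemma coeff_pcompose_second:
  fixes A B :: "'a::idom poly"
  assumes A: "degree A = n" "n > 0" and B: "degree B = m" "m > 0"
  shows "coeff (pcompose A B) (n * m - 1) =
    of_nat n * lead_coeff A * lead_coeff B ^ (n - 1) * coeff B (m - 1) +
    (if m = 1 then coeff A (n - 1) * lead_coeff B ^ (n - 1) else 0)"
proof -
  obtain k where k: "n = Suc k" using A(2) by (cases n) auto
  define A' where "A' = A - monom (lead_coeff A) n"
  have degA': "degree A' \<le> k"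
  proof (rule degree_le, intro allI impI)
    fix i assume "k < i"
    then show "coeff A' i = 0" using A k by (cases "i = n") (auto simp: A'_def coeff_eq_0)
  qed
  have "pcompose A B = smult (lead_coeff A) (B ^ n) + pcompose A' B"
    by (simp add: A'_def pcompose_diff pcompose_monom)
  then have "coeff (pcompose A B) (n * m - 1) = lead_coeff A * coeff (B ^ n) (n * m - 1) + coeff (pcompose A' B) (n * m - 1)"
    by simp
  moreover have "coeff (B ^ n) (n * m - 1) = of_nat n * lead_coeff B ^ (n - 1) * coeff B (m - 1)"
    using coeff_power_second[OF B, of k] k by simp
  moreover have "coeff (pcompose A' B) (n * m - 1) = (if m = 1 then coeff A (n - 1) * lead_coeff B ^ (n - 1) else 0)"
  proof (cases "degree A' < k \<or> m > 1")
    case True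
    have "degree (pcompose A' B) < n * m - 1"
    proof (cases "degree A' < k")
      case less: True
      then have "Suc (degree A') * m \<le> k * m" by (intro mult_right_mono) auto
      then show ?thesis using B k by (simp add: degree_pcompose)
    next
      case False
      then have "m > 1" using True by simp
      have "degree A' * m \<le> k * m" using degA' by (rule mult_le_mono1)
      then have "degree A' * m < m + k * m - 1" using \<open>m > 1\<close> by linarith
      then show ?thesis using B k by (simp add: degree_pcompose)
    qed
    moreover have "coeff A k = 0" if "m = 1"
    proof -
      have "degree A' < k" using True that by simp
      then have "coeff A' k = 0" by (rule coeff_eq_0)
      then show ?thesis using k by (simp add: A'_def)
    qed
    ultimately show ?thesis using k by (simp add: coeff_eq_0)
  next
    case False
    then have m1: "m = 1" and dA': "degree A' = k" using degA' B by auto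
    have "coeff (pcompose A' B) k = lead_coeff A' * lead_coeff B ^ k"
      using lead_coeff_comp[of B A'] B m1 dA' by (simp add: degree_pcompose)
    moreover have "lead_coeff A' = coeff A k" using dA' k by (simp add: A'_def)
    ultimately show ?thesis using m1 k by simp
  qed
  ultimately show ?thesis by (simp add: algebra_simps)
qed

text \<open>
  For positive degree this says that the sum of the roots is zero. Being centred removes the freedom of translation.
\<close>

definition centred :: "'a::field poly \<Rightarrow> bool"
  where "centred p \<longleftrightarrow> coeff p (degree p - 1) = 0"

lemma centred_pcompose_iff:
  fixes A B :: "'a::field_char_0 poly"
  assumes "degree A > 0" "degree B \<ge> 2"
  shows "centred (pcompose A B) \<longleftrightarrow> centred B"
proof -
  have "lead_coeff A \<noteq> 0" "lead_coeff B \<noteq> 0" using assms by auto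
  then show ?thesis
    using coeff_pcompose_second[of A _ B, OF refl assms(1) refl] assms
    by (simp add: centred_def degree_pcompose)
qed

lemma centred_smult_iff: "c \<noteq> 0 \<Longrightarrow> centred (smult c p) \<longleftrightarrow> centred p"
  by (simp add: centred_def)

lemma centred_poly_iter:
  fixes \<theta> :: "'a::field_char_0 poly"
  assumes "degree \<theta> \<ge> 2" "n > 0"
  shows "centred (poly_iter \<theta> n) \<longleftrightarrow> centred \<theta>"
  using centred_pcompose_iff[of "poly_iter \<theta> (n - 1)" \<theta>] assms poly_iter_Suc_right[of \<theta> "n - 1"]
  by (simp add: degree_poly_iter)

text \<open>
  By \<open>ritt_same_degree\<close>, \<open>X\<close> and \<open>Y\<close> differ by an affine map, which also relates \<open>A\<close> and \<open>B\<close>. Since both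
  of these are centred, the affine map has no constant term.
\<close>

lemma centred_same_degree:
  fixes A B X Y :: "'a::field_char_0 poly"
  assumes eq: "pcompose A X = pcompose B Y" and A: "degree A > 0" "centred A" and B: "centred B"
    and XY: "degree X = degree Y" "degree Y > 0"
  shows "\<exists>l. l \<noteq> 0 \<and> X = smult l Y \<and> pcompose A [:0, l:] = B"
proof -
  obtain l k where l: "l \<noteq> 0" "X = smult l Y + [:k:]"
    using ritt_same_degree[OF eq A(1)] XY by auto
  have X: "X = pcompose [:k, l:] Y" by (simp add: l pcompose_pCons mult.commute)
  have AB: "pcompose A [:k, l:] = B"
    using eq XY(2) unfolding X pcompose_assoc by (metis pcompose_right_cancel)
  have dB: "degree B = degree A" using l(1) by (simp add: degree_pcompose flip: AB)
  have "coeff B (degree A - 1) = of_nat (degree A) * lead_coeff A * l ^ (degree A - 1) * k"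
    using coeff_pcompose_second[of A _ "[:k, l:]" 1, OF refl A(1)] l(1) A(2) AB by (simp add: centred_def)
  then have "k = 0" using B dB A(1) l(1) by (auto simp: centred_def)
  then show ?thesis using l AB by auto
qed

text \<open>
  The condition says that all zeros of \<open>f \<circ> p - v\<close> have multiplicity divisible by \<open>a\<close>: at \<open>0\<close> the factor
  \<open>a\<close> comes from \<open>p\<close>, elsewhere from \<open>f\<close>. Hence \<open>f \<circ> p - v\<close> is \<open>c\<close> times an \<open>a\<close>-th power.
\<close>

lemma intertwiner_of_multiplicities:
  fixes f :: "'a::{alg_closed_field,field_char_0} poly"
  assumes deg: "degree f > 0" and a: "a > 0" and c: "c \<noteq> 0"
    and p: "p = [:v:] + smult c (monom 1 a)"
    and v: "poly f v = v" "\<And>x. poly f x = v \<Longrightarrow> x \<noteq> v \<Longrightarrow> a dvd ram f x"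
  shows "\<exists>\<theta>. pcompose f p = pcompose p \<theta>"
proof -
  have mono: "degree (smult c (monom 1 a)) = a" using c by (simp add: degree_monom_eq)
  have degp: "degree p = a" unfolding p using degree_add_eq_right[of "[:v:]" "smult c (monom 1 a)"] mono a by simp
  have posp: "degree p > 0" using degp a by simp
  have pos: "degree (pcompose f p) > 0" using deg posp by (simp add: degree_pcompose)
  have pp: "poly p y = v + c * y ^ a" for y by (simp add: p poly_monom)
  define R where "R = smult (1 / c) (pcompose f p - [:v:])"
  have R0: "R \<noteq> 0" using diff_const_nonzero[OF pos] c by (simp add: R_def)
  have "a dvd order y R" for y
  proof (cases "poly f (poly p y) = v")
    case False
    then have "order y R = 0" using R0 c by (intro order_0I) (simp add: R_def poly_pcompose)
    then show ?thesis by simp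
  next
    case True
    have "order y R = order y (pcompose f p - [:v:])" unfolding R_def by (rule order_smult) (use c in simp)
    also have "\<dots> = ram f (poly p y) * ram p y"
      using True order_diff_const[OF pos, of y v] ram_pcompose[OF deg posp] by (simp add: poly_pcompose)
    finally have ord: "order y R = ram f (poly p y) * ram p y" .
    show ?thesis
    proof (cases "poly p y = v")
      case False
      then show ?thesis using ord v(2)[OF True] by simp
    next
      case pv: True
      then have "y = 0" using c a by (simp add: pp)
      moreover have "p - [:v:] = smult c (monom 1 a)" by (simp add: p)
      ultimately have "ram p y = order 0 (smult c (monom 1 a))"
        unfolding ram_def pv by (simp only:)
      also have "\<dots> = a" using c by (simp add: order_smult)
      finally show ?thesis using ord by simp
    qed
  qed
  from ex_power_of_orders[OF R0 a this] obtain \<theta> where \<theta>: "R = \<theta> ^ a" by blast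
  have "pcompose f p = [:v:] + smult c R" using c by (simp add: R_def)
  also have "\<dots> = pcompose p \<theta>" by (simp add: p \<theta> pcompose_add pcompose_smult pcompose_monom)
  finally show ?thesis by blast
qed

lemma ex_nontrivial_root_of_unity:
  assumes "a \<ge> 2"
  shows "\<exists>\<zeta>::'a::{alg_closed_field,field_char_0}. \<zeta> ^ a = 1 \<and> \<zeta> \<noteq> 1"
proof -
  define P :: "'a poly" where "P = (\<Sum>i<a. monom 1 i)"
  have "coeff P (a - 1) = 1" using assms by (simp add: P_def coeff_sum)
  then have "a - 1 \<le> degree P" by (intro le_degree) simp
  then have "degree P > 0" using assms by simp
  then obtain \<zeta> where "poly P \<zeta> = 0" using alg_closed_imp_poly_has_root by blast
  then have s: "(\<Sum>i<a. \<zeta> ^ i) = 0" by (simp add: P_def poly_sum poly_monom)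
  then have "\<zeta> ^ a - 1 = 0" using power_diff_1_eq[of \<zeta> a] by simp
  moreover have "\<zeta> \<noteq> 1" using s assms by auto
  ultimately show ?thesis by auto
qed

text \<open>
  Since \<open>p\<close> is invariant under the rotation by \<open>\<zeta>\<close> about \<open>t\<close>, the polynomial \<open>\<eta>\<close> is equivariant for it. A
  nontrivial rotational symmetry determines its centre, which for a centred \<open>\<eta>\<close> is \<open>0\<close>.
\<close>

lemma centre_of_power_intertwiner:
  fixes F \<eta> :: "'a::{alg_closed_field,field_char_0} poly"
  assumes inter: "pcompose F p = pcompose p \<eta>" and p: "p = [:v:] + smult c ([:- t, 1:] ^ a)"
    and c: "c \<noteq> 0" and a: "a \<ge> 2" and \<eta>: "degree \<eta> \<ge> 2" "centred \<eta>"
  shows "t = 0"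
proof -
  define D where "D = degree \<eta>"
  obtain \<zeta> :: 'a where \<zeta>: "\<zeta> ^ a = 1" "\<zeta> \<noteq> 1" using ex_nontrivial_root_of_unity[OF a] by blast
  have \<zeta>0: "\<zeta> \<noteq> 0" using \<zeta>(1) a by (auto simp: power_0_left)
  define \<eta>1 where "\<eta>1 = pcompose \<eta> [:t, 1:] - [:t:]"
  define \<eta>2 where "\<eta>2 = pcompose \<eta>1 [:0, \<zeta>:]"
  have pp: "poly p y = v + c * (y - t) ^ a" for y by (simp add: p)
  have e1: "poly \<eta>1 s = poly \<eta> (t + s) - t" for s by (simp add: \<eta>1_def poly_pcompose)
  have pinter: "poly F (poly p y) = poly p (poly \<eta> y)" for y
    using arg_cong[OF inter, of "\<lambda>q. poly q y"] by (simp add: poly_pcompose)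
  have "\<eta>2 ^ a = \<eta>1 ^ a"
  proof (rule poly_eq_poly_eq_iff[THEN iffD1], rule ext)
    fix s
    have "poly p (t + \<zeta> * s) = poly p (t + s)" by (simp add: pp power_mult_distrib \<zeta>(1))
    then have "poly p (poly \<eta> (t + \<zeta> * s)) = poly p (poly \<eta> (t + s))" by (metis pinter)
    then show "poly (\<eta>2 ^ a) s = poly (\<eta>1 ^ a) s" using c by (simp add: pp \<eta>2_def e1 poly_pcompose mult.commute)
  qed
  moreover have dcomp: "degree (pcompose \<eta> [:t, 1:]) = D" by (simp add: D_def degree_pcompose)
  then have d1: "degree \<eta>1 = D" using \<eta>(1) degree_diff_const[of "pcompose \<eta> [:t, 1:]" t] by (simp add: \<eta>1_def D_def)
  then have "\<eta>1 \<noteq> 0" using \<eta>(1) by (auto simp: D_def)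
  ultimately obtain \<xi> where \<xi>: "\<eta>2 = smult \<xi> \<eta>1" using power_eq_imp_smult[of \<eta>2 a \<eta>1] a by auto
  have co: "\<zeta> ^ i * coeff \<eta>1 i = \<xi> * coeff \<eta>1 i" for i
    using arg_cong[OF \<xi>, of "\<lambda>q. coeff q i"] by (simp add: \<eta>2_def coeff_pcompose_linear)
  obtain k where k: "D = Suc (Suc k)" using \<eta>(1) unfolding D_def[symmetric] by (cases D; cases "D - 1") auto
  have "coeff \<eta>1 D \<noteq> 0" using d1 \<open>\<eta>1 \<noteq> 0\<close> by (metis leading_coeff_0_iff)
  then have "\<xi> = \<zeta> ^ D" using co[of D] by simp
  then have "\<zeta> ^ (D - 1) * (1 - \<zeta>) * coeff \<eta>1 (D - 1) = 0" using co[of "D - 1"] k by (simp add: algebra_simps)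
  then have "coeff \<eta>1 (D - 1) = 0" using \<zeta> \<zeta>0 by simp
  moreover have "coeff \<eta>1 (D - 1) = coeff (pcompose \<eta> [:t, 1:]) (D - 1)" by (simp add: \<eta>1_def k)
  moreover have "coeff (pcompose \<eta> [:t, 1:]) (D - 1) = of_nat D * lead_coeff \<eta> * t"
    using coeff_pcompose_second[of \<eta> D "[:t, 1:]" 1] \<eta> k by (simp add: D_def centred_def)
  moreover have "lead_coeff \<eta> \<noteq> 0" using \<eta>(1) by auto
  ultimately show ?thesis using k by (simp del: of_nat_Suc)
qed

text \<open>
  Up to an affine map on the left, \<open>p\<close> is \<open>x\<^sup>a\<close>, so \<open>p \<circ> \<eta> = f\<^sup>M \<circ> p = p \<circ> \<theta>\<^sup>M\<close> determines \<open>\<eta>\<close> up to an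
  \<open>a\<close>-th root of unity. If \<open>\<theta>\<close> were a monomial, the point \<open>p(0)\<close> would be a totally ramified fixed
  point of \<open>f\<close>.
\<close>

lemma coprime_intertwiner_normal_form:
  fixes f p \<eta> :: "'a::{alg_closed_field,field_char_0} poly"
  assumes deg: "degree f \<ge> 2" and M: "M > 0"
    and inter: "pcompose (poly_iter f M) p = pcompose p \<eta>"
    and a: "degree p > 0" "coprime (degree p) (degree f)"
    and cheb: "\<not> cheb_like f" and pow: "\<not> power_like f" and \<eta>: "centred \<eta>"
  shows "\<exists>\<theta> \<xi>. pcompose f p = pcompose p \<theta> \<and> degree \<theta> = degree f \<and> centred \<theta> \<and>
    (\<exists>j<degree f. coeff \<theta> j \<noteq> 0) \<and> \<xi> ^ degree p = 1 \<and> \<eta> = smult \<xi> (poly_iter \<theta> M)"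
proof -
  define a D where "a = degree p" and "D = degree f ^ M"
  have deg\<eta>: "degree \<eta> = D"
    using arg_cong[OF inter, of degree] a by (simp add: degree_pcompose degree_poly_iter D_def)
  have D: "D \<ge> 2" using deg M unfolding D_def by (metis le_trans self_le_power Suc_1 Suc_leD)
  have "\<exists>v c \<theta>. c \<noteq> 0 \<and> p = [:v:] + smult c (monom 1 a) \<and> pcompose f p = pcompose p \<theta>"
  proof (cases "a = 1")
    case True
    then have "degree p = 1" by (simp add: a_def)
    then obtain v c where vc: "p = [:v, c:]" "c \<noteq> 0" by (metis degree1_coeffs)
    define p' where "p' = [:- v / c, 1 / c:]"
    have "pcompose p p' = [:0, 1:]" using vc by (simp add: p'_def pcompose_pCons)
    then have "pcompose p (pcompose p' (pcompose f p)) = pcompose f p" by (simp add: pcompose_assoc)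
    moreover have "p = [:v:] + smult c (monom 1 a)" using vc True by (simp add: monom_Suc)
    ultimately show ?thesis using vc by metis
  next
    case False
    then have a2: "degree p \<ge> 2" using a by (simp add: a_def)
    from coprime_intertwiner_ramification[OF deg M inter a2 a(2) cheb] obtain v t c where
      vtc: "c \<noteq> 0" "p = [:v:] + smult c ([:- t, 1:] ^ degree p)" "poly f v = v"
        "\<forall>x. poly f x = v \<longrightarrow> x \<noteq> v \<longrightarrow> degree p dvd ram f x"
      by blast
    have "t = 0" using centre_of_power_intertwiner[OF inter vtc(2,1) a2] deg\<eta> D \<eta> by simp
    then have p: "p = [:v:] + smult c (monom 1 a)" using vtc(2) by (simp add: a_def monom_altdef)
    have "degree f > 0" "a > 0" using deg a by (simp_all add: a_def)
    moreover have "a dvd ram f x" if "poly f x = v" "x \<noteq> v" for x using vtc(4) that by (simp add: a_def)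
    ultimately obtain \<theta> where "pcompose f p = pcompose p \<theta>"
      using intertwiner_of_multiplicities[OF _ _ vtc(1) p vtc(3)] by blast
    then show ?thesis using p vtc(1) by blast
  qed
  then obtain v c \<theta> where c: "c \<noteq> 0" and p: "p = [:v:] + smult c (monom 1 a)"
    and \<theta>: "pcompose f p = pcompose p \<theta>" by blast
  have deg\<theta>: "degree \<theta> = degree f" using arg_cong[OF \<theta>, of degree] a by (simp add: degree_pcompose)
  have pc: "pcompose p q = [:v:] + smult c (q ^ a)" for q
    by (subst p) (simp add: pcompose_add pcompose_smult pcompose_monom)
  have "pcompose p \<eta> = pcompose p (poly_iter \<theta> M)"
    using poly_iter_intertwine[OF \<theta>, of M] inter by simp
  then have "smult c (\<eta> ^ a) = smult c (poly_iter \<theta> M ^ a)" by (simp add: pc)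
  from arg_cong[OF this, of "smult (1 / c)"] have "\<eta> ^ a = poly_iter \<theta> M ^ a" using c by simp
  moreover have "poly_iter \<theta> M \<noteq> 0" using deg\<theta> deg D degree_poly_iter[of \<theta> M] D_def by auto
  ultimately obtain \<xi> where \<xi>: "\<xi> ^ a = 1" "\<eta> = smult \<xi> (poly_iter \<theta> M)"
    using power_eq_imp_smult[of \<eta> a] a by (auto simp: a_def)
  then have "\<xi> \<noteq> 0" using a by (auto simp: a_def power_0_left)
  then have "centred \<theta>" using \<eta> \<xi>(2) centred_smult_iff centred_poly_iter[of \<theta> M] deg\<theta> deg M by metis
  moreover have "\<exists>j<degree f. coeff \<theta> j \<noteq> 0"
  proof (rule ccontr)
    assume "\<not> (\<exists>j<degree f. coeff \<theta> j \<noteq> 0)"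
    define l where "l = lead_coeff \<theta>"
    have "\<theta> \<noteq> 0" using deg\<theta> deg by auto
    then have l: "l \<noteq> 0" by (simp add: l_def)
    have "\<theta> = monom l (degree f)"
    proof (rule poly_eqI)
      fix i
      show "coeff \<theta> i = coeff (monom l (degree f)) i"
        using \<open>\<not> (\<exists>j<degree f. coeff \<theta> j \<noteq> 0)\<close> deg\<theta>
        by (cases i "degree f" rule: linorder_cases) (auto simp: l_def coeff_eq_0)
    qed
    then have \<theta>0: "poly \<theta> 0 = 0" and ord: "order 0 \<theta> = degree f"
      using deg l by (simp_all add: poly_monom power_0_left)
    have pos: "degree f > 0" "degree p > 0" "degree \<theta> > 0" using deg deg\<theta> a by simp_all
    have ram\<theta>: "ram \<theta> 0 = degree f" using \<theta>0 ord by (simp add: ram_def)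
    have "ram f (poly p 0) * ram p 0 = ram p 0 * ram \<theta> 0"
      using arg_cong[OF \<theta>, of "\<lambda>q. ram q 0"] ram_pcompose[OF pos(1,2)] ram_pcompose[OF pos(2,3)] \<theta>0 by simp
    then have "ram f (poly p 0) = degree f" using ram\<theta> ram_pos[OF pos(2), of 0] by simp
    moreover have "poly f (poly p 0) = poly p 0"
      using arg_cong[OF \<theta>, of "\<lambda>q. poly q 0"] \<theta>0 by (simp add: poly_pcompose)
    ultimately show False using pow by (auto simp: power_like_def)
  qed
  ultimately show ?thesis using \<theta> deg\<theta> \<xi> unfolding a_def by blast
qed

lemma coprime_powers_eq_1:
  fixes \<rho> :: "'a::field"
  assumes "\<rho> ^ m = 1" "\<rho> ^ n = 1" "coprime m n" "m > 0"
  shows "\<rho> = 1"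
proof -
  have \<rho>: "\<rho> \<noteq> 0" using assms(1,4) by (auto simp: power_0_left)
  obtain x y where "m * x = n * y + 1" using bezout_nat[of m n] assms(3,4) by (auto simp: coprime_iff_gcd_eq_1)
  then have "\<rho> ^ (m * x) = \<rho> ^ (n * y + 1)" by (rule arg_cong)
  then show ?thesis using assms(1,2) by (simp add: power_mult)
qed

text \<open>
  Uniqueness of right factors, applied twice to \<open>\<psi>\<^sup>M = \<kappa> \<theta>\<^sup>M\<close>, gives first \<open>\<psi> = \<omega> \<theta>\<close> and then the symmetry
  \<open>\<theta>(\<omega> x) = \<omega>\<^sup>\<delta> \<theta>(x)\<close>; two cancellations leave a positive iterate only if \<open>M \<ge> 3\<close>. A coefficient
  of \<open>\<theta>\<close> in degree \<open>j < \<delta>\<close> shows that \<open>\<omega>\<close> has order dividing \<open>m = \<delta> - j\<close>. With \<open>S i\<close> the sum of the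
  first \<open>i\<close> powers of \<open>\<delta>\<close>, one has \<open>\<psi>\<^sup>i = \<omega>\<close>\<open>\<^sup>S\<^sup>i \<theta>\<^sup>i\<close>, and two of the \<open>m + 1\<close> numbers \<open>S 0, \<dots>, S m\<close> agree
  modulo \<open>m\<close>. Their difference is a power of \<open>\<delta>\<close> times some \<open>S N\<close>, and the power of \<open>\<delta>\<close> can be cancelled
  in the exponent because \<open>\<kappa> = \<omega>\<close>\<open>\<^sup>S\<^sup>M\<close> has order prime to \<open>\<delta>\<close>.
\<close>

lemma common_iterate:
  fixes \<theta> \<psi> :: "'a::field_char_0 poly"
  assumes deg: "degree \<theta> = \<delta>" "degree \<psi> = \<delta>" "\<delta> \<ge> 2"
    and cent: "centred \<theta>" "centred \<psi>" and M: "M \<ge> 3"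
    and eq: "poly_iter \<psi> M = smult \<kappa> (poly_iter \<theta> M)"
    and \<kappa>: "\<kappa> ^ e = 1" "e > 0" "coprime e \<delta>"
    and nonmonom: "\<exists>j<\<delta>. coeff \<theta> j \<noteq> 0"
  shows "\<exists>N>0. N \<le> \<delta> \<and> poly_iter \<psi> N = poly_iter \<theta> N"
proof -
  have \<kappa>0: "\<kappa> \<noteq> 0" using \<kappa> by (auto simp: power_0_left)
  obtain K where K: "M = Suc (Suc K)" "K > 0" using that[of "M - 2"] M by auto
  have degit: "degree (poly_iter \<theta> i) > 0" "degree (poly_iter \<psi> i) > 0" for i
    using deg by (simp_all add: degree_poly_iter)
  have cit: "centred (poly_iter \<psi> i)" "centred (smult \<kappa> (poly_iter \<theta> i))" if "i > 0" for i
    using that centred_poly_iter[of \<psi> i] centred_poly_iter[of \<theta> i] deg cent \<kappa>0 centred_smult_iff by auto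
  have "pcompose (poly_iter \<psi> (Suc K)) \<psi> = pcompose (smult \<kappa> (poly_iter \<theta> (Suc K))) \<theta>"
    using eq by (simp add: K(1) poly_iter_Suc_right pcompose_smult)
  from centred_same_degree[OF this degit(2) cit(1)[OF zero_less_Suc] cit(2)[OF zero_less_Suc]] obtain \<omega> where
    \<omega>: "\<omega> \<noteq> 0" "\<psi> = smult \<omega> \<theta>" "pcompose (poly_iter \<psi> (Suc K)) [:0, \<omega>:] = smult \<kappa> (poly_iter \<theta> (Suc K))"
    using deg by auto
  have "pcompose (poly_iter \<psi> K) (pcompose \<psi> [:0, \<omega>:]) = pcompose (smult \<kappa> (poly_iter \<theta> K)) \<theta>"
    using \<omega>(3) by (simp add: poly_iter_Suc_right pcompose_smult pcompose_assoc)
  from centred_same_degree[OF this degit(2) cit(1)[OF K(2)] cit(2)[OF K(2)]] obtain \<mu> where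
    \<mu>: "pcompose \<psi> [:0, \<omega>:] = smult \<mu> \<theta>"
    using deg \<omega>(1) by (auto simp: degree_pcompose)
  have co: "\<omega> * (\<omega> ^ j * coeff \<theta> j) = \<mu> * coeff \<theta> j" for j
    using arg_cong[OF \<mu>, of "\<lambda>q. coeff q j"] by (simp add: \<omega>(2) pcompose_smult coeff_pcompose_linear)
  have "\<theta> \<noteq> 0" using deg by auto
  then have "coeff \<theta> \<delta> \<noteq> 0" using deg(1) by (metis leading_coeff_0_iff)
  then have "\<mu> = \<omega> * \<omega> ^ \<delta>" using co[of \<delta>] by simp
  then have co: "\<omega> ^ j = \<omega> ^ \<delta>" if "coeff \<theta> j \<noteq> 0" for j using co[of j] that \<omega>(1) by simp
  obtain j where j: "j < \<delta>" "coeff \<theta> j \<noteq> 0" using nonmonom by blast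
  define m where "m = \<delta> - j"
  have m: "m > 0" "m \<le> \<delta>" using j by (simp_all add: m_def)
  have "\<omega> ^ j * \<omega> ^ m = \<omega> ^ j"
  proof -
    have "j + m = \<delta>" using j(1) by (simp add: m_def)
    then show ?thesis unfolding power_add[symmetric] using co[OF j(2)] by simp
  qed
  then have \<omega>m: "\<omega> ^ m = 1" using \<omega>(1) by simp
  have scale: "pcompose \<theta> (smult (\<omega> ^ s) q) = smult (\<omega> ^ (\<delta> * s)) (pcompose \<theta> q)" for s q
  proof -
    have "pcompose \<theta> [:0, \<omega> ^ s:] = smult (\<omega> ^ (\<delta> * s)) \<theta>"
    proof (rule poly_eqI)
      fix i
      have "(\<omega> ^ s) ^ i = \<omega> ^ (\<delta> * s)" if "coeff \<theta> i \<noteq> 0"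
      proof -
        have "(\<omega> ^ s) ^ i = (\<omega> ^ i) ^ s" by (simp only: power_mult[symmetric] mult.commute)
        also have "\<dots> = \<omega> ^ (\<delta> * s)" by (simp only: co[OF that] power_mult)
        finally show ?thesis .
      qed
      then show "coeff (pcompose \<theta> [:0, \<omega> ^ s:]) i = coeff (smult (\<omega> ^ (\<delta> * s)) \<theta>) i"
        unfolding coeff_pcompose_linear coeff_smult by (cases "coeff \<theta> i = 0") simp_all
    qed
    then have "pcompose (pcompose \<theta> [:0, \<omega> ^ s:]) q = pcompose (smult (\<omega> ^ (\<delta> * s)) \<theta>) q" by simp
    then show ?thesis by (simp add: pcompose_smult pcompose_pCons mult.commute flip: pcompose_assoc)
  qed
  define S where "S = (\<lambda>i. \<Sum>j<i. \<delta> ^ j)"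
  have S_Suc: "S (Suc i) = 1 + \<delta> * S i" for i
    unfolding S_def by (subst sum.lessThan_Suc_shift) (simp add: sum_distrib_left)
  have iter: "poly_iter \<psi> i = smult (\<omega> ^ S i) (poly_iter \<theta> i)" for i
  proof (induction i)
    case 0
    show ?case by (simp add: S_def)
  next
    case (Suc i)
    have "poly_iter \<psi> (Suc i) = smult \<omega> (pcompose \<theta> (smult (\<omega> ^ S i) (poly_iter \<theta> i)))"
      unfolding poly_iter_Suc Suc by (subst \<omega>(2)) (simp add: pcompose_smult)
    also have "\<dots> = smult (\<omega> ^ S (Suc i)) (poly_iter \<theta> (Suc i))"
      unfolding scale S_Suc by (simp add: poly_iter_Suc)
    finally show ?case .
  qed
  have "poly_iter \<theta> M \<noteq> 0" using degit(1)[of M] by auto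
  then have \<kappa>S: "\<kappa> = \<omega> ^ S M"
    using eq iter[of M] by (metis leading_coeff_0_iff lead_coeff_smult mult_cancel_right)
  \<comment> \<open>If \<open>\<rho> = \<omega>\<^sup>k\<close> satisfies \<open>\<rho>\<^sup>\<delta> = 1\<close>, then raising it to the power \<open>S M\<close>, which is 1 modulo \<open>\<delta>\<close>, leaves it
    unchanged; so \<open>\<rho>\<close> is a power of \<open>\<kappa>\<close> and its order is also prime to \<open>\<delta>\<close>.\<close>
  have cancel: "\<omega> ^ k = 1" if "\<omega> ^ (\<delta> * k) = 1" for k
  proof (rule coprime_powers_eq_1[where m = e and n = \<delta>])
    show "(\<omega> ^ k) ^ \<delta> = 1" using that by (simp add: mult.commute flip: power_mult)
    then have "(\<omega> ^ k) ^ S M = \<omega> ^ k" by (simp add: K(1) S_Suc power_add power_mult)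
    moreover have "((\<omega> ^ k) ^ S M) ^ e = 1"
      by (metis \<kappa>S \<kappa>(1) power_commuting_commutes power_mult mult.commute power_one)
    ultimately show "(\<omega> ^ k) ^ e = 1" by simp
  qed (use \<kappa> in auto)
  have cancel_pow: "\<omega> ^ k = 1" if "\<omega> ^ (\<delta> ^ i * k) = 1" for i k
    using that by (induction i) (auto simp: mult.assoc dest: cancel)
  have "\<not> inj_on (\<lambda>i. S i mod m) {0..m}"
  proof
    assume "inj_on (\<lambda>i. S i mod m) {0..m}"
    then have "card {0..m} \<le> card {..<m}" using m(1) by (intro card_inj_on_le) auto
    then show False by simp
  qed
  then obtain i k where ik: "i \<in> {0..m}" "k \<in> {0..m}" "S i mod m = S k mod m" "i \<noteq> k" by (auto simp: inj_on_def)
  have "\<exists>i k. i < k \<and> k \<le> m \<and> S i mod m = S k mod m"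
  proof (cases "i < k")
    case True
    then show ?thesis using ik by auto
  next
    case False
    then show ?thesis using ik by (intro exI[of _ k] exI[of _ i]) auto
  qed
  then obtain i k where ik: "i < k" "k \<le> m" "S i mod m = S k mod m" by blast
  define N where "N = k - i"
  have N: "N > 0" "N \<le> \<delta>" using ik m by (simp_all add: N_def)
  have S_add: "S (i + n) = S i + \<delta> ^ i * S n" for n
    by (induction n) (simp_all add: S_def algebra_simps power_add)
  have red: "\<omega> ^ s = \<omega> ^ (s mod m)" for s
    by (metis \<omega>m mult_1 mult_div_mod_eq power_add power_mult power_one)
  have "\<omega> ^ S i = \<omega> ^ S k" using ik(3) red by metis
  moreover have "S k = S i + \<delta> ^ i * S N" using S_add[of N] ik(1) by (simp add: N_def)
  ultimately have "\<omega> ^ S i * \<omega> ^ (\<delta> ^ i * S N) = \<omega> ^ S i" by (simp add: power_add)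
  then have "\<omega> ^ (\<delta> ^ i * S N) = 1" using \<omega>(1) by simp
  then have "\<omega> ^ S N = 1" by (rule cancel_pow)
  then show ?thesis using N iter[of N] by auto
qed

lemma ex_centring_translation:
  fixes \<eta> :: "'a::field_char_0 poly"
  assumes "degree \<eta> \<ge> 2"
  shows "\<exists>t. centred (pcompose (pcompose [:- t, 1:] \<eta>) [:t, 1:])"
proof -
  define D where "D = degree \<eta>"
  have D: "D \<ge> 2" and lc: "lead_coeff \<eta> \<noteq> 0" using assms by (auto simp: D_def)
  define t where "t = - coeff \<eta> (D - 1) / (of_nat D * lead_coeff \<eta>)"
  define \<eta>' where "\<eta>' = pcompose [:- t, 1:] \<eta>"
  have deg: "degree \<eta>' = D" by (simp add: \<eta>'_def degree_pcompose D_def)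
  have eq: "\<eta>' = [:- t:] + \<eta>" by (simp add: \<eta>'_def pcompose_pCons)
  obtain k where k: "D = Suc (Suc k)" using D by (cases D; cases "D - 1") auto
  have "coeff \<eta>' D = lead_coeff \<eta>" "coeff \<eta>' (D - 1) = coeff \<eta> (D - 1)" by (simp_all add: eq k D_def[symmetric])
  then have "coeff (pcompose \<eta>' [:t, 1:]) (D - 1) = of_nat D * lead_coeff \<eta> * t + coeff \<eta> (D - 1)"
    using coeff_pcompose_second[of \<eta>' D "[:t, 1:]" 1] deg D by simp
  also have "\<dots> = 0" using lc D by (simp add: t_def)
  finally have "centred (pcompose \<eta>' [:t, 1:])" using deg by (simp add: centred_def degree_pcompose)
  then show ?thesis unfolding \<eta>'_def by blast
qed

section \<open>A common semiconjugate polynomial for a bounded iterate\<close>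

theorem theorem2p3:
  fixes f g :: "'a::{alg_closed_field, field_char_0} poly" and d :: nat
  assumes "d \<ge> 2"
    and "disintegrated f" and "degree f \<le> d"
    and "disintegrated g" and "degree g \<le> d"
    and "approx_rel f g"
  shows "\<exists>N>0. N \<le> 2 * d ^ 4 \<and>
    (\<exists>\<eta>. semiconjugate \<eta> (poly_iter f N) \<and> semiconjugate \<eta> (poly_iter g N))"
proof -
  note f = disintegratedD[OF assms(2)] and g = disintegratedD[OF assms(4)]
  obtain m \<eta>0 p0 q0 where m: "m > 0" "degree \<eta>0 \<ge> 2" "degree p0 > 0" "degree q0 > 0"
    "pcompose (poly_iter f m) p0 = pcompose p0 \<eta>0" "pcompose (poly_iter g m) q0 = pcompose q0 \<eta>0"
    using assms(6) unfolding approx_rel_def semiconjugate_def by blast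
  define \<delta> where "\<delta> = degree f"
  have "degree f ^ m = degree \<eta>0" "degree g ^ m = degree \<eta>0"
    using arg_cong[OF m(5), of degree] arg_cong[OF m(6), of degree] m(3,4)
    by (simp_all add: degree_pcompose degree_poly_iter)
  then have degg: "degree g = \<delta>" using power_eq_imp_eq_base[of "degree g" m "degree f"] m(1) by (simp add: \<delta>_def)
  have iter3: "poly_iter h (m * 3) = pcompose (poly_iter h m) (pcompose (poly_iter h m) (poly_iter h m))" for h :: "'a poly"
    by (simp add: numeral_3_eq_3 poly_iter_add)
  \<comment> \<open>Passing to the third iterate ensures \<open>M \<ge> 3\<close>.\<close>
  define M \<eta>1 where "M = m * 3" and "\<eta>1 = pcompose \<eta>0 (pcompose \<eta>0 \<eta>0)"
  have M: "M \<ge> 3" "M > 0" using m(1) by (simp_all add: M_def)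
  have deg\<eta>1: "degree \<eta>1 \<ge> 2"
    using m(2) mult_le_mono[of 2 "degree \<eta>0" 1 "degree \<eta>0 * degree \<eta>0"] by (simp add: \<eta>1_def degree_pcompose)
  have f1: "pcompose (poly_iter f M) p0 = pcompose p0 \<eta>1"
    unfolding M_def \<eta>1_def iter3 by (metis m(5) pcompose_assoc)
  have g1: "pcompose (poly_iter g M) q0 = pcompose q0 \<eta>1"
    unfolding M_def \<eta>1_def iter3 by (metis m(6) pcompose_assoc)
  obtain f' u p1 where f': "degree f' = \<delta>" "degree u > 0" "pcompose f u = pcompose u f'"
    "pcompose (poly_iter f' M) p1 = pcompose p1 \<eta>1" "degree p1 > 0" "coprime (degree p1) \<delta>"
    "\<not> cheb_like f'" "\<not> power_like f'"
    using reduce_to_coprime[OF f(1) M(2) f1 m(3) f(2,3)] unfolding \<delta>_def by blast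
  obtain g' w q1 where g': "degree g' = \<delta>" "degree w > 0" "pcompose g w = pcompose w g'"
    "pcompose (poly_iter g' M) q1 = pcompose q1 \<eta>1" "degree q1 > 0" "coprime (degree q1) \<delta>"
    "\<not> cheb_like g'" "\<not> power_like g'"
    using reduce_to_coprime[OF g(1) M(2) g1 m(4) g(2,3)] unfolding degg by blast
  \<comment> \<open>One translation of the common source centres \<open>\<eta>\<close> for both intertwiners simultaneously.\<close>
  obtain t where t: "centred (pcompose (pcompose [:- t, 1:] \<eta>1) [:t, 1:])"
    using ex_centring_translation[OF deg\<eta>1] by blast
  define \<eta> p q where "\<eta> = pcompose (pcompose [:- t, 1:] \<eta>1) [:t, 1:]"
    and "p = pcompose p1 [:t, 1:]" and "q = pcompose q1 [:t, 1:]"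
  have tt: "pcompose [:t, 1:] [:- t, 1:] = [:0, 1:]" by (simp add: pcompose_pCons)
  have shift: "pcompose F (pcompose r [:t, 1:]) = pcompose (pcompose r [:t, 1:]) \<eta>"
    if "pcompose F r = pcompose r \<eta>1" for F r
  proof -
    have "pcompose (pcompose r [:t, 1:]) \<eta> = pcompose (pcompose r (pcompose (pcompose [:t, 1:] [:- t, 1:]) \<eta>1)) [:t, 1:]"
      by (simp only: \<eta>_def pcompose_assoc)
    then show ?thesis unfolding tt by (simp add: pcompose_assoc that)
  qed
  have pq: "degree p = degree p1" "degree q = degree q1" by (simp_all add: p_def q_def degree_pcompose)
  have fp: "pcompose (poly_iter f' M) p = pcompose p \<eta>" unfolding p_def by (rule shift[OF f'(4)])
  have gq: "pcompose (poly_iter g' M) q = pcompose q \<eta>" unfolding q_def by (rule shift[OF g'(4)])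
  have \<delta>: "\<delta> \<ge> 2" using f(1) by (simp add: \<delta>_def)
  obtain \<psi> \<xi> where \<psi>: "pcompose f' p = pcompose p \<psi>" "degree \<psi> = \<delta>" "centred \<psi>"
      "\<xi> ^ degree p = 1" "\<eta> = smult \<xi> (poly_iter \<psi> M)"
    using coprime_intertwiner_normal_form[OF _ M(2) fp] f' \<delta> pq t unfolding \<eta>_def[symmetric] by auto
  obtain \<theta> \<xi>' where \<theta>: "pcompose g' q = pcompose q \<theta>" "degree \<theta> = \<delta>" "centred \<theta>"
      "\<exists>j<\<delta>. coeff \<theta> j \<noteq> 0" "\<xi>' ^ degree q = 1" "\<eta> = smult \<xi>' (poly_iter \<theta> M)"
    using coprime_intertwiner_normal_form[OF _ M(2) gq] g' \<delta> pq t unfolding \<eta>_def[symmetric] by auto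
  have \<xi>0: "\<xi> \<noteq> 0" "\<xi>' \<noteq> 0" using \<psi>(4) \<theta>(5) pq f'(5) g'(5) by (auto simp: power_0_left)
  have "smult (1 / \<xi>) (smult \<xi> (poly_iter \<psi> M)) = smult (1 / \<xi>) (smult \<xi>' (poly_iter \<theta> M))"
    using \<psi>(5) \<theta>(6) by simp
  then have eq: "poly_iter \<psi> M = smult (\<xi>' / \<xi>) (poly_iter \<theta> M)" using \<xi>0 by simp
  have \<kappa>: "(\<xi>' / \<xi>) ^ (degree p * degree q) = 1"
  proof -
    have "\<xi> ^ (degree p * degree q) = 1" by (simp only: power_mult \<psi>(4) power_one)
    moreover have "\<xi>' ^ (degree p * degree q) = 1" by (subst mult.commute) (simp only: power_mult \<theta>(5) power_one)
    ultimately show ?thesis by (simp add: power_divide)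
  qed
  have "coprime (degree p * degree q) \<delta>" using f'(6) g'(6) by (simp add: pq)
  moreover have "degree p * degree q > 0" using f'(5) g'(5) by (simp add: pq)
  ultimately obtain N where N: "N > 0" "N \<le> \<delta>" "poly_iter \<psi> N = poly_iter \<theta> N"
    using common_iterate[OF \<theta>(2) \<psi>(2) \<delta> \<theta>(3) \<psi>(3) M(1) eq \<kappa>] \<theta>(4) by blast
  define \<epsilon> where "\<epsilon> = poly_iter \<theta> N"
  have deg\<epsilon>: "\<delta> ^ N \<ge> 2" using \<delta> N(1) by (metis le_trans self_le_power Suc_1 Suc_leD)
  have semi: "semiconjugate \<epsilon> (poly_iter h N)"
    if "degree h = \<delta>" "pcompose h u = pcompose u h'" "pcompose h' p = pcompose p \<tau>" "poly_iter \<tau> N = \<epsilon>"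
      "degree u > 0" "degree p > 0" "degree \<tau> = \<delta>" for h h' u p \<tau>
  proof -
    have "pcompose (poly_iter h N) (pcompose u p) = pcompose (pcompose u p) \<epsilon>"
      using poly_iter_intertwine[OF that(2), of N] poly_iter_intertwine[OF that(3), of N] that(4)
      by (metis pcompose_assoc)
    moreover have "degree (pcompose u p) > 0" using that by (simp add: degree_pcompose)
    moreover have "degree \<epsilon> \<ge> 2" "degree (poly_iter h N) \<ge> 2"
      using that(1,7) deg\<epsilon> by (simp_all add: degree_poly_iter flip: that(4))
    ultimately show ?thesis unfolding semiconjugate_def by blast
  qed
  have "semiconjugate \<epsilon> (poly_iter f N)"
    by (rule semi[OF _ f'(3) \<psi>(1)]) (use N(3) f' \<psi>(2) pq in \<open>simp_all add: \<epsilon>_def \<delta>_def\<close>)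
  moreover have "semiconjugate \<epsilon> (poly_iter g N)"
    by (rule semi[OF degg g'(3) \<theta>(1)]) (use g' \<theta>(2) pq in \<open>simp_all add: \<epsilon>_def\<close>)
  moreover have "N \<le> 2 * d ^ 4"
  proof -
    have "N \<le> d" using N(2) assms(3) by (simp add: \<delta>_def)
    also have "d \<le> d ^ 4" by (rule self_le_power) (use assms(1) in auto)
    finally show ?thesis by simp
  qed
  ultimately show ?thesis using N(1) by blast
qed

end
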